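(* There is a polynomial-time algorithm which, given a finite metric space $(V,d)$ and a positive integer $k$, computes a set $\{T_1,\dots,T_t\}$ of at most $k$ trees whose vertex sets cover $V$, such that for every $p\in[1,\infty)$ and every tree cover $\{\hat T_1,\dots,\hat T_k\}$ of $(V,d)$ of size $k$, $$\Big(\sum_{i=1}^t w(T_i)^p\Big)^{1/p}\le 14\Big(\sum_{i=1}^k w(\hat T_i)^p\Big)^{1/p}.$$
   Context: A finite metric space $(V,d)$ is identified with the complete (edge-weighted) graph on $V$ with edge weights $d$. A tree is a tree in this graph on some subset of $V$ (a single vertex is allowed); its weight is $w(T)=\sum_{uv\in E(T)} d(u,v)$. A tree cover of size $k$ is a collection of $k$ trees whose vertex sets together cover $V$; the trees need not be disjoint. *)

theory Defs
  imports "HOL-Analysis.Analysis" "HOL-Computational_Algebra.Polynomial"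
begin

section \<open>Trees in the complete graph on a finite metric space\<close>

record 'a ugraph =
  verts :: "'a set"
  edges :: "'a set set"

definition connected_graph :: "'a ugraph \<Rightarrow> bool" where
  "connected_graph T \<longleftrightarrow>
     (\<forall>u\<in>verts T. \<forall>v\<in>verts T. (u, v) \<in> {(x, y). {x, y} \<in> edges T}\<^sup>*)"

definition is_cycle :: "'a ugraph \<Rightarrow> 'a list \<Rightarrow> bool" where
  "is_cycle T xs \<longleftrightarrow> length xs \<ge> 3 \<and> distinct xs \<and>
     (\<forall>i<length xs. {xs ! i, xs ! (Suc i mod length xs)} \<in> edges T)"

definition tree_in :: "'a set \<Rightarrow> 'a ugraph \<Rightarrow> bool" where
  "tree_in V T \<longleftrightarrow> verts T \<subseteq> V \<and> verts T \<noteq> {} \<and>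
     edges T \<subseteq> {{u, v} | u v. u \<in> verts T \<and> v \<in> verts T \<and> u \<noteq> v} \<and>
     connected_graph T \<and> (\<nexists>xs. is_cycle T xs)"

text \<open>The length of an unordered pair; it is well defined because distances are symmetric
  (see \<open>edge_length_doubleton\<close>).\<close>

definition edge_length :: "('a \<Rightarrow> 'a \<Rightarrow> real) \<Rightarrow> 'a set \<Rightarrow> real" where
  "edge_length d e = (THE r. \<exists>u v. e = {u, v} \<and> r = d u v)"

lemma edge_length_doubleton:
  assumes "Metric_space V d"
  shows "edge_length d {u, v} = d u v"
  unfolding edge_length_def
  by (rule the_equality) (auto simp: doubleton_eq_iff Metric_space.commute[OF assms])

definition weight :: "('a \<Rightarrow> 'a \<Rightarrow> real) \<Rightarrow> 'a ugraph \<Rightarrow> real" where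
  "weight d T = (\<Sum>e\<in>edges T. edge_length d e)"

text \<open>The members of a cover of size \<open>k\<close> are indexed by \<open>{..<k}\<close>; they may overlap and repeat.\<close>

definition tree_cover :: "'a set \<Rightarrow> nat \<Rightarrow> (nat \<Rightarrow> 'a ugraph) \<Rightarrow> bool" where
  "tree_cover V k T \<longleftrightarrow> (\<forall>i<k. tree_in V (T i)) \<and> (\<Union>i<k. verts (T i)) = V"


section \<open>Programs and their running time\<close>

text \<open>
  The machine model is a random-access machine whose input distances are real numbers. It has a
  memory for natural numbers and one for real numbers. Cells have two-part addresses (array and
  position, or row and column), which are computed from natural numbers.

  There is no multiplication, on either sort, and real numbers can only be added, subtracted and
  compared; they cannot be rounded or converted. So the uniform cost measure cannot be abused:
  on rational input, the bit lengths of all values arising in \<open>t\<close> steps are bounded by a polynomial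
  in \<open>t\<close> and the bit length of the input. A program whose number of steps is polynomial
  in this model therefore runs in polynomial time on a Turing machine for rational input.
\<close>

record state =
  nmem :: "nat \<Rightarrow> nat \<Rightarrow> nat"
  rmem :: "nat \<Rightarrow> nat \<Rightarrow> real"

datatype nexp = NConst nat | NLoad nexp nexp | NAdd nexp nexp | NSub nexp nexp

datatype rexp = RLoad nexp nexp | RAdd rexp rexp | RSub rexp rexp

datatype bexp = NLess nexp nexp | RLess rexp rexp | BNot bexp | BAnd bexp bexp

datatype com =
    Skip
  | NStore nexp nexp nexp
  | RStore nexp nexp rexp
  | Seq com com
  | If bexp com com
  | While bexp com

primrec nval :: "nexp \<Rightarrow> state \<Rightarrow> nat" where
  "nval (NConst a) s = a"
| "nval (NLoad a b) s = nmem s (nval a s) (nval b s)"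
| "nval (NAdd a b) s = nval a s + nval b s"
| "nval (NSub a b) s = nval a s - nval b s"

primrec rval :: "rexp \<Rightarrow> state \<Rightarrow> real" where
  "rval (RLoad a b) s = rmem s (nval a s) (nval b s)"
| "rval (RAdd a b) s = rval a s + rval b s"
| "rval (RSub a b) s = rval a s - rval b s"

primrec bval :: "bexp \<Rightarrow> state \<Rightarrow> bool" where
  "bval (NLess a b) s \<longleftrightarrow> nval a s < nval b s"
| "bval (RLess a b) s \<longleftrightarrow> rval a s < rval b s"
| "bval (BNot a) s \<longleftrightarrow> \<not> bval a s"
| "bval (BAnd a b) s \<longleftrightarrow> bval a s \<and> bval b s"

definition nupdate :: "nat \<Rightarrow> nat \<Rightarrow> nat \<Rightarrow> state \<Rightarrow> state" where
  "nupdate i j x s = s\<lparr>nmem := (nmem s)(i := (nmem s i)(j := x))\<rparr>"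

definition rupdate :: "nat \<Rightarrow> nat \<Rightarrow> real \<Rightarrow> state \<Rightarrow> state" where
  "rupdate i j x s = s\<lparr>rmem := (rmem s)(i := (rmem s i)(j := x))\<rparr>"

text \<open>\<open>exec c s t s'\<close>: started in \<open>s\<close>, the program \<open>c\<close> halts in \<open>s'\<close> after \<open>t\<close> steps.
  Every assignment and every evaluation of a condition is one step. The expressions of a program
  have a fixed size, so charging for the operators in them would change \<open>t\<close> by at most a constant
  factor depending on \<open>c\<close>.\<close>

inductive exec :: "com \<Rightarrow> state \<Rightarrow> nat \<Rightarrow> state \<Rightarrow> bool" where
  Skip: "exec Skip s 1 s"
| NStore: "exec (NStore a b e) s 1 (nupdate (nval a s) (nval b s) (nval e s) s)"
| RStore: "exec (RStore a b e) s 1 (rupdate (nval a s) (nval b s) (rval e s) s)"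
| Seq: "exec c1 s t1 s1 \<Longrightarrow> exec c2 s1 t2 s2 \<Longrightarrow> exec (Seq c1 c2) s (t1 + t2) s2"
| IfTrue: "bval b s \<Longrightarrow> exec c1 s t s' \<Longrightarrow> exec (If b c1 c2) s (Suc t) s'"
| IfFalse: "\<not> bval b s \<Longrightarrow> exec c2 s t s' \<Longrightarrow> exec (If b c1 c2) s (Suc t) s'"
| WhileFalse: "\<not> bval b s \<Longrightarrow> exec (While b c) s 1 s"
| WhileTrue: "bval b s \<Longrightarrow> exec c s t1 s1 \<Longrightarrow> exec (While b c) s1 t2 s2 \<Longrightarrow>
    exec (While b c) s (Suc (t1 + t2)) s2"

lemma exec_deterministic:
  assumes "exec c s t s'" and "exec c s t' s''"
  shows "t' = t \<and> s'' = s'"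
  using assms
proof (induction arbitrary: t' s'' rule: exec.induct)
  case (Seq c1 s t1 s1 c2 t2 s2)
  from Seq.prems show ?case by cases (use Seq.IH in blast)
next
  case (WhileTrue b s c t1 s1 t2 s2)
  from WhileTrue.prems show ?case by cases (use WhileTrue.hyps WhileTrue.IH in blast)+
qed (erule exec.cases; auto)+


section \<open>Encoding of instances and solutions\<close>

text \<open>The points are numbered \<open>0, \<dots>, n - 1\<close>. Initially, the real memory holds the distance
  matrix, row 0 of the natural memory holds \<open>n\<close> and \<open>k\<close>, and all other cells are 0.\<close>

definition input_state :: "nat \<Rightarrow> (nat \<Rightarrow> nat \<Rightarrow> real) \<Rightarrow> nat \<Rightarrow> state" where
  "input_state n d k =
     \<lparr>nmem = (\<lambda>i j. if i = 0 \<and> j = 0 then n else if i = 0 \<and> j = 1 then k else 0),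
      rmem = (\<lambda>u v. if u < n \<and> v < n then d u v else 0)\<rparr>"

text \<open>
  On halting, cells \<open>(0, 0)\<close>, \<open>(0, 1)\<close> and \<open>(0, 2)\<close> of the natural memory hold the number of trees,
  of vertex records and of edge records. The vertex record \<open>i\<close> in rows 1 and 2 puts vertex \<open>(2, i)\<close>
  into the tree with number \<open>(1, i)\<close>; the edge record \<open>i\<close> in rows 3, 4 and 5 puts the edge between
  \<open>(4, i)\<close> and \<open>(5, i)\<close> into the tree with number \<open>(3, i)\<close>.
\<close>

definition output_tree :: "state \<Rightarrow> nat \<Rightarrow> nat ugraph" where
  "output_tree s j =
     \<lparr>verts = {nmem s 2 i | i. i < nmem s 0 1 \<and> nmem s 1 i = j},
      edges = {{nmem s 4 i, nmem s 5 i} | i. i < nmem s 0 2 \<and> nmem s 3 i = j}\<rparr>"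

definition output_trees :: "state \<Rightarrow> nat ugraph set" where
  "output_trees s = output_tree s ` {..<nmem s 0 0}"

end

theory Submission
  imports Defs
begin

text \<open>
  Kruskal's algorithm merges clusters along shortest crossing edges and keeps, for every cluster, a
  closed tour of length at most twice the weight \<open>w\<close> of its minimum spanning tree; merging two tours
  along an edge \<open>uv\<close> just exchanges the successors of \<open>u\<close> and \<open>v\<close>. With a radius \<open>R\<close> between the longest
  edge used and the shortest crossing distance, the tours are cut into paths of length at most \<open>12 R\<close>.
  While there are more than \<open>k\<close> paths, the algorithm either merges (if there are more than \<open>k\<close> clusters
  or the next edge is at most \<open>2 R\<close>) or doubles \<open>R\<close>. Since at most a factor 2 is lost in the last step,
  the too many paths of the round before certify numbers \<open>E\<close> with \<open>w \<ge> 3 R E\<close> in each cluster and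
  \<open>\<Sum>(E + 1) \<ge> k\<close>.

  Such a certificate bounds every tree cover from below at all scales: a cover using \<open>q\<close> connected
  pieces inside a cluster spends at least \<open>w - R (q - 1)\<close> there, and every additional piece of a tree
  costs a crossing edge of length at least \<open>R\<close>. This yields \<open>\<Sum> max 0 (a - 14 l) \<le> 14 \<Sum> max 0 (b - l)\<close>
  for all \<open>l \<ge> 0\<close>, where \<open>a\<close> ranges over the path lengths and \<open>b\<close> over the tree weights of the cover,
  and this weak majorization implies the inequality for all norms at once.
\<close>

section \<open>Weak majorization\<close>

text \<open>All exponents must be served at once, and the hinge functions
  \<open>max 0 (x - l)\<close> make this possible: on any finite set of points,
  \<open>x powr p\<close> is a nonnegative combination of them, so \<open>p\<close> disappears from
  the combinatorial part. The constants depend on each other. A tour is up to twice as long as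
  \<open>w\<close>, so every cut of a tour at length \<open>12 * R\<close> is backed by
  \<open>6 * R\<close> of \<open>w\<close>, and \<open>3 * R\<close> are left when \<open>R\<close>
  grows by at most the factor 2. The lower bound charges \<open>R + l\<close> for each unit of
  \<open>E\<close>; as only scales \<open>l < R\<close> matter, this is less than
  \<open>2 * R\<close>, and at least a third of \<open>w\<close> survives the charge. Scales are
  limited by \<open>14 * l < 12 * R\<close>, and a cluster with \<open>w \<le> 7 * l\<close> has no
  path longer than \<open>14 * l\<close>. Polynomial time needs a bound on the doublings. After a
  merge \<open>R\<close> restarts at the length \<open>e\<close> of the edge just used, so
  \<open>R = 2 ^ j * e\<close>; a tour that still has to be cut is longer than
  \<open>12 * R\<close>, yet its cluster has \<open>w\<close> at most \<open>n * e\<close>. Doubling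
  also suits a machine that can only add, subtract and compare reals.\<close>

lemma powr_three_slopes:
  fixes x y t p :: real
  assumes "p \<ge> 1" "0 \<le> y" "y < x" "x \<le> t"
  shows "(x powr p - y powr p) * (t - x) \<le> (t powr p - x powr p) * (x - y)"
proof (cases "x = t")
  case False
  then have xt: "x < t" using assms by simp
  show ?thesis
  \<comment> \<open>At \<open>y = 0\<close> the claim is the monotonicity of
    \<open>x powr (p - 1)\<close>, multiplied by \<open>t * x\<close>; for \<open>y > 0\<close> it
    compares two slopes of a convex function.\<close>
  proof (cases "y = 0")
    case True
    have "x powr (p - 1) \<le> t powr (p - 1)"
      using assms by (intro powr_mono2) auto
    then have "t * x * x powr (p - 1) \<le> t * x * t powr (p - 1)"
      using assms by (intro mult_left_mono) auto
    moreover have "x * x powr (p - 1) = x powr p" "t * t powr (p - 1) = t powr p"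
      using assms by (simp_all add: powr_mult_base)
    ultimately have "t * x powr p \<le> x * t powr p"
      by (metis mult.assoc mult.commute)
    then show ?thesis using True assms by (simp add: algebra_simps)
  next
    case False
    have "(y powr p - x powr p) / (y - x) \<le> (x powr p - t powr p) / (x - t)"
      using convex_on_slope_le[OF powr_convex[OF assms(1)], of y t x] False assms xt by force
    then have "(x powr p - y powr p) / (x - y) \<le> (t powr p - x powr p) / (t - x)"
      by (metis minus_diff_eq minus_divide_divide)
    then show ?thesis using xt assms by (simp add: field_simps)
  qed
qed simp

text \<open>Piecewise linear interpolation written with hinge functions: the coefficients are the
  initial slope and the later increases of the slope, nonnegative because the power is increasing
  and convex.\<close>

lemma powr_piecewise_linear:
  fixes p :: real
  assumes "p \<ge> 1" "finite S" "\<forall>x\<in>S. 0 < x"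
  shows "\<exists>c. (\<forall>l. 0 \<le> c l) \<and>
    (\<forall>x\<in>insert 0 S. (\<Sum>l\<in>insert 0 S. c l * max 0 (x - l)) = x powr p)"
proof -
  \<comment> \<open>The third conjunct strengthens the induction: beyond the last point the
    interpolant stays below the power, so the next change of slope is nonnegative.\<close>
  have "\<exists>c. (\<forall>l. 0 \<le> c l) \<and>
      (\<forall>x\<in>insert 0 S. (\<Sum>l\<in>insert 0 S. c l * max 0 (x - l)) = x powr p) \<and>
      (\<forall>t. (\<forall>x\<in>insert 0 S. x \<le> t) \<longrightarrow> (\<Sum>l\<in>insert 0 S. c l * max 0 (t - l)) \<le> t powr p)"
    using assms(2,3)
  proof (induction S rule: finite_linorder_max_induct)
    case empty
    show ?case by (rule exI[of _ "\<lambda>_. 0"]) auto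
  next
    case (insert x A)
    let ?A = "insert 0 A"
    obtain c where c: "\<forall>l. 0 \<le> c l"
      and eq: "\<And>z. z \<in> ?A \<Longrightarrow> (\<Sum>l\<in>?A. c l * max 0 (z - l)) = z powr p"
      and le: "\<And>t. \<forall>z\<in>?A. z \<le> t \<Longrightarrow> (\<Sum>l\<in>?A. c l * max 0 (t - l)) \<le> t powr p"
proof -
      have "\<forall>x\<in>A. 0 < x" using insert.prems by simp
      from insert.IH[OF this] show ?thesis using that by blast
    qed
    define y where "y = Max ?A"
    have fin: "finite ?A" using insert by simp
    have yA: "y \<in> ?A" unfolding y_def by (rule Max_in) (use fin in auto)
    have ymax: "z \<le> y" if "z \<in> ?A" for z unfolding y_def by (rule Max_ge[OF fin that])
    have yx: "y < x" and y0: "0 \<le> y" using yA insert by auto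
    have xA: "x \<notin> ?A" using yx ymax by force
    define g where "g = (\<lambda>z. \<Sum>l\<in>?A. c l * max 0 (z - l))"
    have gx: "g x \<le> x powr p" unfolding g_def by (rule le) (use ymax yx in force)
    have gy: "g y = y powr p" unfolding g_def by (rule eq[OF yA])
    define s where "s = (x powr p - g x) / (x - y)"
    have s0: "s \<ge> 0" unfolding s_def using gx yx by simp
    \<comment> \<open>The interpolant bends at the last old point \<open>y\<close>, by the extra
      slope \<open>s\<close> that makes it reach \<open>x powr p\<close>; the new knot
      \<open>x\<close> stays inactive until a larger point arrives.\<close>
    define c' where "c' = c(y := c y + s, x := 0)"
    have sumc': "(\<Sum>l\<in>insert 0 (insert x A). c' l * max 0 (z - l)) = g z + s * max 0 (z - y)" for z
    proof -
      have "(\<Sum>l\<in>insert 0 (insert x A). c' l * max 0 (z - l))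
          = (\<Sum>l\<in>insert x ?A. c' l * max 0 (z - l))"
        by (simp add: insert_commute)
      also have "\<dots> = (\<Sum>l\<in>?A. c' l * max 0 (z - l))"
        using fin xA by (subst sum.insert) (auto simp: c'_def)
      also have "\<dots> = (\<Sum>l\<in>?A. c l * max 0 (z - l) + (if l = y then s * max 0 (z - l) else 0))"
        by (rule sum.cong) (use xA in \<open>auto simp: c'_def algebra_simps\<close>)
      also have "\<dots> = g z + s * max 0 (z - y)"
        unfolding sum.distrib g_def using fin yA by (simp add: sum.delta)
      finally show ?thesis .
    qed
    have aff: "g z = g y + (\<Sum>l\<in>?A. c l) * (z - y)" if "y \<le> z" for z
    proof -
      have "g z = (\<Sum>l\<in>?A. c l * (y - l) + c l * (z - y))" unfolding g_def
      proof (rule sum.cong)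
        fix l assume "l \<in> ?A"
        then have "max 0 (z - l) = (y - l) + (z - y)" using ymax[of l] that by simp
        then show "c l * max 0 (z - l) = c l * (y - l) + c l * (z - y)"
          by (simp add: algebra_simps)
      qed simp
      also have "\<dots> = (\<Sum>l\<in>?A. c l * (y - l)) + (\<Sum>l\<in>?A. c l) * (z - y)"
        by (simp only: sum.distrib sum_distrib_right)
      also have "(\<Sum>l\<in>?A. c l * (y - l)) = g y" unfolding g_def
        by (rule sum.cong) (use ymax in \<open>auto simp: max_def\<close>)
      finally show ?thesis .
    qed
    have slope: "g t + s * (t - y) \<le> t powr p" if "x \<le> t" for t
    proof -
      let ?K = "(\<Sum>l\<in>?A. c l) + s"
      have K: "?K * (x - y) = x powr p - y powr p"
        unfolding s_def using aff[of x] yx gy by (simp add: field_simps)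
      have "g t + s * (t - y) = y powr p + ?K * (x - y) + ?K * (t - x)"
        using aff[of t] that yx gy by (simp add: algebra_simps)
      also have "\<dots> = x powr p + ?K * (t - x)" using K by simp
      also have "?K * (t - x) \<le> t powr p - x powr p"
      proof -
        have "(?K * (x - y)) * (t - x) \<le> (t powr p - x powr p) * (x - y)"
          unfolding K using powr_three_slopes[OF assms(1) y0 yx that] .
        then have "(?K * (t - x)) * (x - y) \<le> (t powr p - x powr p) * (x - y)"
          by (simp add: algebra_simps)
        then show ?thesis using yx by simp
      qed
      finally show ?thesis by simp
    qed
    show ?case
    proof (intro exI[of _ c'] conjI allI ballI impI)
      show "0 \<le> c' l" for l using c s0 by (simp add: c'_def)
    next
      fix z assume z: "z \<in> insert 0 (insert x A)"
      show "(\<Sum>l\<in>insert 0 (insert x A). c' l * max 0 (z - l)) = z powr p"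
      proof (cases "z = x")
        case True
        then show ?thesis unfolding sumc' using yx by (simp add: s_def)
      next
        case False
        then have "z \<in> ?A" using z by auto
        then show ?thesis unfolding sumc' using ymax[of z] eq[of z] by (simp add: g_def max_def)
      qed
    next
      fix t assume "\<forall>z\<in>insert 0 (insert x A). z \<le> t"
      then show "(\<Sum>l\<in>insert 0 (insert x A). c' l * max 0 (t - l)) \<le> t powr p"
        unfolding sumc' using slope[of t] yx by simp
    qed
  qed
  then show ?thesis by blast
qed

text \<open>After division of \<open>a\<close> by \<open>c\<close>, both power sums are the same
  nonnegative combination of hinge sums, with knots at 0 and at the values that occur; the
  hypothesis compares them knot by knot.\<close>

lemma weak_majorization_powr:
  fixes a :: "'i \<Rightarrow> real" and b :: "'j \<Rightarrow> real" and c p :: real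
  assumes p: "p \<ge> 1" and c: "c > 0" and fin: "finite I" "finite J"
    and a: "\<And>i. i \<in> I \<Longrightarrow> 0 \<le> a i" and b: "\<And>j. j \<in> J \<Longrightarrow> 0 \<le> b j"
    and maj: "\<And>l. l \<ge> 0 \<Longrightarrow> (\<Sum>i\<in>I. max 0 (a i - c * l)) \<le> c * (\<Sum>j\<in>J. max 0 (b j - l))"
  shows "(\<Sum>i\<in>I. a i powr p) powr (1 / p) \<le> c * (\<Sum>j\<in>J. b j powr p) powr (1 / p)"
proof -
  define a' where "a' = (\<lambda>i. a i / c)"
  have a': "0 \<le> a' i" if "i \<in> I" for i using a[OF that] c by (simp add: a'_def)
  have maj': "(\<Sum>i\<in>I. max 0 (a' i - l)) \<le> (\<Sum>j\<in>J. max 0 (b j - l))" if "l \<ge> 0" for l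
  proof -
    have "c * (\<Sum>i\<in>I. max 0 (a' i - l)) = (\<Sum>i\<in>I. max 0 (a i - c * l))"
      unfolding sum_distrib_left
      by (rule sum.cong) (use c in \<open>auto simp: a'_def max_def field_simps\<close>)
    then have "c * (\<Sum>i\<in>I. max 0 (a' i - l)) \<le> c * (\<Sum>j\<in>J. max 0 (b j - l))"
      using maj[OF that] by simp
    then show ?thesis by (rule mult_left_le_imp_le) (rule c)
  qed
  define S where "S = (a' ` I \<union> b ` J) - {0}"
  have S: "finite S" "\<forall>x\<in>S. 0 < x" using fin a' b by (auto simp: S_def order_less_le)
  obtain f where f: "\<And>l. 0 \<le> f l"
    and eq: "\<And>x. x \<in> insert 0 S \<Longrightarrow> (\<Sum>l\<in>insert 0 S. f l * max 0 (x - l)) = x powr p"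
    using powr_piecewise_linear[OF p S] by blast
  have "(\<Sum>i\<in>I. a' i powr p) = (\<Sum>i\<in>I. \<Sum>l\<in>insert 0 S. f l * max 0 (a' i - l))"
    by (intro sum.cong refl eq[symmetric]) (simp add: S_def)
  also have "\<dots> = (\<Sum>l\<in>insert 0 S. f l * (\<Sum>i\<in>I. max 0 (a' i - l)))"
    by (subst sum.swap) (simp only: sum_distrib_left)
  also have "\<dots> \<le> (\<Sum>l\<in>insert 0 S. f l * (\<Sum>j\<in>J. max 0 (b j - l)))"
    by (intro sum_mono mult_left_mono maj' f) (use S in auto)
  also have "\<dots> = (\<Sum>j\<in>J. \<Sum>l\<in>insert 0 S. f l * max 0 (b j - l))"
    by (subst sum.swap) (simp only: sum_distrib_left)
  also have "\<dots> = (\<Sum>j\<in>J. b j powr p)"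
    by (intro sum.cong refl eq) (simp add: S_def)
  finally have le: "(\<Sum>i\<in>I. a' i powr p) \<le> (\<Sum>j\<in>J. b j powr p)" .
  have "(\<Sum>i\<in>I. a i powr p) = c powr p * (\<Sum>i\<in>I. a' i powr p)"
    unfolding sum_distrib_left
    by (rule sum.cong) (use a a' c in \<open>auto simp: a'_def powr_mult[symmetric]\<close>)
  then have "(\<Sum>i\<in>I. a i powr p) powr (1 / p) = (c powr p * (\<Sum>i\<in>I. a' i powr p)) powr (1 / p)"
    by simp
  also have "\<dots> = c * (\<Sum>i\<in>I. a' i powr p) powr (1 / p)"
    using c p by (simp add: powr_mult sum_nonneg powr_powr)
  also have "\<dots> \<le> c * (\<Sum>j\<in>J. b j powr p) powr (1 / p)"
    using le c p by (intro mult_left_mono powr_mono2) (auto intro: sum_nonneg)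
  finally show ?thesis .
qed


section \<open>Lower bounds for tree covers\<close>

definition inside :: "'a set set \<Rightarrow> 'a set \<Rightarrow> 'a set set" where
  "inside F C = {e \<in> F. e \<subseteq> C}"

lemma finite_inside [simp]: "finite F \<Longrightarrow> finite (inside F C)"
  by (simp add: inside_def)

text \<open>A vertex set grows along crossing edges, one edge per new vertex. The new edge lies
  inside \<open>S\<close> only if both its ends do; then the new vertex enlarges
  \<open>W \<inter> S\<close> as well, so the forest inequality survives for every \<open>S\<close>
  at once.\<close>

lemma spanning_subtree:
  assumes fin: "finite (verts T)" and con: "connected_graph T" and ne: "verts T \<noteq> {}"
    and ed: "edges T \<subseteq> {{u, v} | u v. u \<in> verts T \<and> v \<in> verts T \<and> u \<noteq> v}"
  shows "\<exists>F \<subseteq> edges T. card F + 1 = card (verts T) \<and>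
    (\<forall>S. S \<inter> verts T \<noteq> {} \<longrightarrow> card (inside F S) + 1 \<le> card (verts T \<inter> S))"
proof -
  have "\<exists>W F. W \<subseteq> verts T \<and> card W = Suc m \<and> F \<subseteq> edges T \<and> F \<subseteq> Pow W \<and> card F = m \<and>
      (\<forall>S. S \<inter> W \<noteq> {} \<longrightarrow> card (inside F S) + 1 \<le> card (W \<inter> S))"
    if "Suc m \<le> card (verts T)" for m
    using that
  proof (induction m)
    case 0
    obtain v where v: "v \<in> verts T" using ne by blast
    show ?case
      by (rule exI[of _ "{v}"], rule exI[of _ "{}"]) (use v in \<open>auto simp: inside_def\<close>)
  next
    case (Suc m)
    then obtain W F where W: "W \<subseteq> verts T" "card W = Suc m" and F: "F \<subseteq> edges T" "F \<subseteq> Pow W" "card F = m"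
      and S: "\<And>S. S \<inter> W \<noteq> {} \<Longrightarrow> card (inside F S) + 1 \<le> card (W \<inter> S)"
      by (metis Suc_leD)
    have finW: "finite W" using W fin finite_subset by blast
    then have finF: "finite F" using F(2) by (metis finite_Pow_iff finite_subset)
    obtain w where w: "w \<in> W" using W by fastforce
    have "W \<noteq> verts T" using W Suc.prems by auto
    then obtain z where z: "z \<in> verts T" "z \<notin> W" using W by blast
    have wz: "(w, z) \<in> {(x, y). {x, y} \<in> edges T}\<^sup>*"
      using con w z W unfolding connected_graph_def by blast
    have "\<exists>x y. x \<in> W \<and> y \<notin> W \<and> {x, y} \<in> edges T"
    proof (rule ccontr)
      assume no: "\<not> ?thesis"
      from wz have "z \<in> W"
        by (induction rule: rtrancl_induct) (use w no in auto)
      then show False using z by simp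
    qed
    then obtain x y where xy: "x \<in> W" "y \<notin> W" "{x, y} \<in> edges T" by blast
    have y: "y \<in> verts T" using xy(3) ed by (force simp: doubleton_eq_iff)
    have new: "{x, y} \<notin> F" using F(2) xy by auto
    let ?W = "insert y W" and ?F = "insert {x, y} F"
    have "card (inside ?F S) + 1 \<le> card (?W \<inter> S)" if nS: "S \<inter> ?W \<noteq> {}" for S
    proof (cases "{x, y} \<subseteq> S")
      case True
      have "inside ?F S = insert {x, y} (inside F S)" using True by (auto simp: inside_def)
      then have "card (inside ?F S) = Suc (card (inside F S))"
        using new finF by (simp add: inside_def)
      moreover have "card (?W \<inter> S) = Suc (card (W \<inter> S))"
        using True xy finW by simp
      moreover have "S \<inter> W \<noteq> {}" using True xy by blast
      ultimately show ?thesis using S[of S] by simp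
    next
      case False
      then have eq: "inside ?F S = inside F S" by (auto simp: inside_def)
      show ?thesis
      proof (cases "S \<inter> W = {}")
        case True
        have "inside F S = {}"
        proof (rule ccontr)
          assume "inside F S \<noteq> {}"
          then obtain e where "e \<in> F" "e \<subseteq> S" by (auto simp: inside_def)
          moreover have "e \<subseteq> W" using \<open>e \<in> F\<close> F by auto
          ultimately have "e = {}" using True by blast
          then show False using \<open>e \<in> F\<close> F ed by blast
        qed
        moreover have "?W \<inter> S = {y}" using True nS by auto
        ultimately show ?thesis using eq by simp
      next
        case False
        have "card (W \<inter> S) \<le> card (?W \<inter> S)" by (rule card_mono) (use finW in auto)
        then show ?thesis using S[OF False] eq by simp
      qed
    qed
    moreover have "card ?W = Suc (Suc m)" "card ?F = Suc m"
      using W F xy finW finF new by auto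
    ultimately show ?case using W F y xy
      by (intro exI[of _ ?W] exI[of _ ?F]) auto
  qed
  from this[of "card (verts T) - 1"]
  obtain W F where W: "W \<subseteq> verts T" "card W = card (verts T)" and F: "F \<subseteq> edges T" "card F = card (verts T) - 1"
    "\<forall>S. S \<inter> W \<noteq> {} \<longrightarrow> card (inside F S) + 1 \<le> card (W \<inter> S)"
    using fin ne by (metis Suc_pred' card_gt_0_iff order_refl)
  have "W = verts T" using W fin by (metis card_subset_eq)
  then show ?thesis using F fin ne
    by (intro exI[of _ F]) (auto simp: Suc_le_eq card_gt_0_iff)
qed

section \<open>Components and weight of a forest inside a cluster\<close>

definition inside_weight :: "('a \<Rightarrow> 'a \<Rightarrow> real) \<Rightarrow> 'a set set \<Rightarrow> 'a set \<Rightarrow> real" where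
  "inside_weight d F C = (\<Sum>e\<in>inside F C. edge_length d e)"

text \<open>Vertices minus edges: the number of components of a forest restricted to
  \<open>C\<close>, in a form that is additive over disjoint sets up to crossing edges. Being real,
  it fits into linear inequalities without truncated subtraction.\<close>

definition parts :: "'a set \<Rightarrow> 'a set set \<Rightarrow> 'a set \<Rightarrow> real" where
  "parts U F C = real (card (U \<inter> C)) - real (card (inside F C))"

text \<open>Only counts survive of the trees: one edge fewer than vertices overall, and at most that
  on every vertex set that a tree touches. Components never have to be formed explicitly.\<close>

locale cover_family =
  fixes V :: "'a set" and d :: "'a \<Rightarrow> 'a \<Rightarrow> real" and K :: nat
    and U :: "nat \<Rightarrow> 'a set" and F :: "nat \<Rightarrow> 'a set set"
  assumes metric: "Metric_space V d" and finV: "finite V"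
    and cover: "(\<Union>i<K. U i) = V"
    and pairs: "i < K \<Longrightarrow> F i \<subseteq> {{u, v} | u v. u \<in> U i \<and> v \<in> U i \<and> u \<noteq> v}"
    and card_F: "i < K \<Longrightarrow> card (F i) + 1 = card (U i)"
    and forest: "i < K \<Longrightarrow> S \<inter> U i \<noteq> {} \<Longrightarrow> card (inside (F i) S) + 1 \<le> card (U i \<inter> S)"
begin

lemma UV: "i < K \<Longrightarrow> U i \<subseteq> V"
  using cover by blast

lemma finU: "i < K \<Longrightarrow> finite (U i)"
  using UV finV finite_subset by blast

lemma finF: "i < K \<Longrightarrow> finite (F i)"
proof -
  assume i: "i < K"
  have "F i \<subseteq> Pow (U i)" using pairs[OF i] by auto
  then show ?thesis using finU[OF i] by (simp add: finite_subset)
qed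

lemma edge_length_nonneg: "i < K \<Longrightarrow> e \<in> F i \<Longrightarrow> 0 \<le> edge_length d e"
proof -
  assume i: "i < K" "e \<in> F i"
  then obtain u v where "e = {u, v}" using pairs[OF i(1)] by auto
  then show ?thesis
    using Metric_space.nonneg[OF metric] by (simp add: edge_length_doubleton[OF metric])
qed

lemma inside_weight_nonneg: "i < K \<Longrightarrow> 0 \<le> inside_weight d (F i) C"
  unfolding inside_weight_def by (rule sum_nonneg) (auto simp: inside_def intro: edge_length_nonneg)

lemma untouched:
  assumes "i < K" "C \<inter> U i = {}"
  shows "inside (F i) C = {}"
proof (rule ccontr)
  assume "\<not> ?thesis"
  then obtain e where e: "e \<in> F i" "e \<subseteq> C" by (auto simp: inside_def)
  then obtain u v where "e = {u, v}" "u \<in> U i" using pairs[OF assms(1)] by auto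
  then show False using e assms(2) by auto
qed

text \<open>Supplies the gap between 0 and 1 of the real-valued count, which replaces integrality
  when a single tree is analysed later.\<close>

lemma parts_cases:
  assumes "i < K"
  shows "C \<inter> U i = {} \<and> parts (U i) (F i) C = 0 \<and> inside_weight d (F i) C = 0
    \<or> C \<inter> U i \<noteq> {} \<and> 1 \<le> parts (U i) (F i) C"
proof (cases "C \<inter> U i = {}")
  case True
  then show ?thesis
    using untouched[OF assms True] by (simp add: parts_def inside_weight_def Int_commute)
next
  case False
  then show ?thesis using forest[OF assms False] by (simp add: parts_def)
qed

lemma parts_nonneg: "i < K \<Longrightarrow> 0 \<le> parts (U i) (F i) C"
  using parts_cases[of i C] by fastforce

lemma sum_parts_ge_1:
  assumes "C \<subseteq> V" "C \<noteq> {}"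
  shows "1 \<le> (\<Sum>i<K. parts (U i) (F i) C)"
proof -
  obtain i where i: "i < K" "C \<inter> U i \<noteq> {}" using assms cover by blast
  have "1 \<le> parts (U i) (F i) C" using i parts_cases[of i C] by auto
  also have "\<dots> \<le> (\<Sum>i<K. parts (U i) (F i) C)"
    by (rule member_le_sum) (use i parts_nonneg in auto)
  finally show ?thesis .
qed

end

text \<open>Behind this is the exchange argument for minimum spanning trees: a forest with
  \<open>q\<close> components on \<open>C\<close> is completed by \<open>q - 1\<close> tree edges of
  length at most \<open>R\<close>. Quantifying over all families allows the bound to be carried
  along the merges without defining the spanning tree.\<close>

definition cover_bound :: "'a set \<Rightarrow> ('a \<Rightarrow> 'a \<Rightarrow> real) \<Rightarrow> 'a set \<Rightarrow> real \<Rightarrow> real \<Rightarrow> bool" where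
  "cover_bound V d C w R \<longleftrightarrow> (\<forall>K U F. cover_family V d K U F \<longrightarrow>
     w \<le> (\<Sum>i<K. inside_weight d (F i) C) + R * ((\<Sum>i<K. parts (U i) (F i) C) - 1))"

text \<open>The factor of \<open>R\<close> is nonnegative, because a nonempty \<open>C\<close> is
  covered by at least one component.\<close>

lemma cover_bound_mono:
  assumes "cover_bound V d C w R" "R \<le> R'" "C \<subseteq> V" "C \<noteq> {}"
  shows "cover_bound V d C w R'"
  unfolding cover_bound_def
proof (intro allI impI)
  fix K U F assume fam: "cover_family V d K U F"
  have "w \<le> (\<Sum>i<K. inside_weight d (F i) C) + R * ((\<Sum>i<K. parts (U i) (F i) C) - 1)"
    using assms(1) fam by (simp add: cover_bound_def)
  moreover have "R * ((\<Sum>i<K. parts (U i) (F i) C) - 1) \<le> R' * ((\<Sum>i<K. parts (U i) (F i) C) - 1)"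
    using cover_family.sum_parts_ge_1[OF fam assms(3,4)] assms(2) by (intro mult_right_mono) auto
  ultimately show "w \<le> (\<Sum>i<K. inside_weight d (F i) C) + R' * ((\<Sum>i<K. parts (U i) (F i) C) - 1)"
    by simp
qed

lemma cover_bound_singleton:
  assumes "v \<in> V" "0 \<le> R"
  shows "cover_bound V d {v} 0 R"
  unfolding cover_bound_def
proof (intro allI impI)
  fix K U F assume fam: "cover_family V d K U F"
  then interpret cover_family V d K U F .
  show "0 \<le> (\<Sum>i<K. inside_weight d (F i) {v}) + R * ((\<Sum>i<K. parts (U i) (F i) {v}) - 1)"
    using sum_parts_ge_1[of "{v}"] assms by (intro add_nonneg_nonneg sum_nonneg mult_nonneg_nonneg inside_weight_nonneg) auto
qed

text \<open>Every edge of the family between \<open>A\<close> and \<open>B\<close> costs at least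
  \<open>e\<close> and removes one component, so a charge of \<open>e\<close> per component absorbs
  it. Two terms \<open>- 1\<close> become one, which yields the additional \<open>e\<close>.\<close>

lemma cover_bound_merge:
  assumes "cover_bound V d A a e" "cover_bound V d B b e" "A \<inter> B = {}"
    and far: "\<And>u v. u \<in> A \<Longrightarrow> v \<in> B \<Longrightarrow> e \<le> d u v"
  shows "cover_bound V d (A \<union> B) (a + b + e) e"
  unfolding cover_bound_def
proof (intro allI impI)
  fix K U F assume fam: "cover_family V d K U F"
  then interpret cover_family V d K U F .
  define X where "X = (\<lambda>i. {f \<in> inside (F i) (A \<union> B). \<not> f \<subseteq> A \<and> \<not> f \<subseteq> B})"
  have split: "inside (F i) (A \<union> B) = inside (F i) A \<union> (inside (F i) B \<union> X i)" for i
    by (auto simp: inside_def X_def)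
  have fX: "finite (X i)" if "i < K" for i using finF[OF that] by (simp add: X_def)
  have nonempty: "f \<noteq> {}" if "i < K" "f \<in> F i" for i f using pairs[OF that(1)] that(2) by auto
  have disj: "inside (F i) A \<inter> (inside (F i) B \<union> X i) = {}" "inside (F i) B \<inter> X i = {}" if "i < K" for i
    using nonempty[OF that] assms(3) by (auto simp: inside_def X_def)
  have cost: "e \<le> edge_length d f" if i: "i < K" and fX: "f \<in> X i" for i f
  proof -
    have "f \<in> F i" using fX by (simp add: X_def inside_def)
    then obtain u v where f: "f = {u, v}" using pairs[OF i] by auto
    have "f \<subseteq> A \<union> B" "\<not> f \<subseteq> A" "\<not> f \<subseteq> B" using fX by (auto simp: X_def inside_def)
    then have "u \<in> A \<and> v \<in> B \<or> v \<in> A \<and> u \<in> B" using f by auto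
    then show ?thesis using far f edge_length_doubleton[OF metric] by (metis insert_commute)
  qed
  have iw: "inside_weight d (F i) (A \<union> B) \<ge> inside_weight d (F i) A + inside_weight d (F i) B + e * card (X i)"
    if i: "i < K" for i
  proof -
    have "inside_weight d (F i) (A \<union> B) = inside_weight d (F i) A + (inside_weight d (F i) B + sum (edge_length d) (X i))"
      unfolding inside_weight_def split using disj[OF i] fX[OF i] finF[OF i]
      by (simp add: sum.union_disjoint)
    moreover have "e * card (X i) \<le> sum (edge_length d) (X i)"
      using sum_bounded_below[of "X i" e "edge_length d"] cost[OF i] by (simp add: mult.commute)
    ultimately show ?thesis by simp
  qed
  have pt: "parts (U i) (F i) (A \<union> B) = parts (U i) (F i) A + parts (U i) (F i) B - card (X i)"
    if i: "i < K" for i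
  proof -
    have "card (inside (F i) (A \<union> B)) = card (inside (F i) A) + (card (inside (F i) B) + card (X i))"
      unfolding split using disj[OF i] fX[OF i] finF[OF i] by (simp add: card_Un_disjoint)
    moreover have "card (U i \<inter> (A \<union> B)) = card (U i \<inter> A) + card (U i \<inter> B)"
      using assms(3) finU[OF i] by (subst card_Un_disjoint[symmetric]) (auto simp: Int_Un_distrib)
    ultimately show ?thesis by (simp add: parts_def)
  qed
  have a: "a \<le> (\<Sum>i<K. inside_weight d (F i) A) + e * ((\<Sum>i<K. parts (U i) (F i) A) - 1)"
    and b: "b \<le> (\<Sum>i<K. inside_weight d (F i) B) + e * ((\<Sum>i<K. parts (U i) (F i) B) - 1)"
    using assms(1,2) fam by (auto simp: cover_bound_def)
  have "(\<Sum>i<K. inside_weight d (F i) A) + (\<Sum>i<K. inside_weight d (F i) B) + e * (\<Sum>i<K. real (card (X i)))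
      \<le> (\<Sum>i<K. inside_weight d (F i) (A \<union> B))"
    unfolding sum.distrib[symmetric] sum_distrib_left by (rule sum_mono) (use iw in auto)
  moreover have "(\<Sum>i<K. parts (U i) (F i) (A \<union> B))
      = (\<Sum>i<K. parts (U i) (F i) A) + (\<Sum>i<K. parts (U i) (F i) B) - (\<Sum>i<K. real (card (X i)))"
    unfolding sum.distrib[symmetric] sum_subtractf[symmetric] by (rule sum.cong) (use pt in auto)
  ultimately show "a + b + e \<le> (\<Sum>i<K. inside_weight d (F i) (A \<union> B))
      + e * ((\<Sum>i<K. parts (U i) (F i) (A \<union> B)) - 1)"
    using a b by (simp add: distrib_left right_diff_distrib)
qed

section \<open>Combining the lower bounds of all clusters\<close>

context cover_family
begin

text \<open>The factor \<open>(R + l) / (R - l)\<close> is attained by a tree of the cover that joins two light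
  clusters by a single edge of length \<open>R\<close>.\<close>

lemma excess_lower_bound:
  fixes w :: "'r \<Rightarrow> real" and E :: "'r \<Rightarrow> nat"
  assumes P: "finite P" "\<And>r. r \<in> P \<Longrightarrow> C r \<noteq> {}" "(\<Union>r\<in>P. C r) = V"
    "\<And>r s. r \<in> P \<Longrightarrow> s \<in> P \<Longrightarrow> r \<noteq> s \<Longrightarrow> C r \<inter> C s = {}"
    and lb: "\<And>r. r \<in> P \<Longrightarrow> cover_bound V d (C r) (w r) R"
    and far: "\<And>r s u v. r \<in> P \<Longrightarrow> s \<in> P \<Longrightarrow> r \<noteq> s \<Longrightarrow> u \<in> C r \<Longrightarrow> v \<in> C s \<Longrightarrow> R \<le> d u v"
    and L: "L \<subseteq> P" "\<And>r. r \<in> P - L \<Longrightarrow> E r = 0"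
    and K: "K \<le> (\<Sum>r\<in>P. E r + 1)" and l: "0 \<le> l" "l < R"
  shows "(R - l) * (\<Sum>r\<in>L. w r - (R + l) * E r - l)
    \<le> (R + l) * (\<Sum>i<K. max 0 (sum (edge_length d) (F i) - l))"
proof -
  let ?iw = "\<lambda>i r. inside_weight d (F i) (C r)" and ?q = "\<lambda>i r. parts (U i) (F i) (C r)"
  have finL: "finite L" by (rule finite_subset[OF L(1) P(1)])
  \<comment> \<open>\<open>ins\<close> and \<open>ql\<close> collect weight and components of tree
    \<open>i\<close> in the clusters of \<open>L\<close>, \<open>qs\<close> its components in the
    others, which offer no weight but still have to be touched.\<close>
  define ins where "ins = (\<lambda>i. \<Sum>r\<in>L. ?iw i r)"
  define ql where "ql = (\<lambda>i. \<Sum>r\<in>L. ?q i r)"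
  define qs where "qs = (\<lambda>i. \<Sum>r\<in>P-L. ?q i r)"
  have "(\<Sum>r\<in>L. w r) \<le> (\<Sum>r\<in>L. (\<Sum>i<K. ?iw i r) + R * ((\<Sum>i<K. ?q i r) - 1))"
    by (rule sum_mono) (use lb L in \<open>auto simp: cover_bound_def cover_family_axioms\<close>)
  also have "\<dots> = (\<Sum>i<K. ins i + R * ql i) - R * card L"
  proof -
    have "(\<Sum>i<K. ins i + R * ql i) = (\<Sum>r\<in>L. \<Sum>i<K. ?iw i r) + R * (\<Sum>r\<in>L. \<Sum>i<K. ?q i r)"
      unfolding ins_def ql_def sum.distrib sum_distrib_left[symmetric]
      by (simp only: sum.swap[of _ L "{..<K}"])
    then show ?thesis
      by (simp add: sum.distrib sum_subtractf right_diff_distrib sum_distrib_left mult.commute)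
  qed
  finally have wL: "(\<Sum>r\<in>L. w r) \<le> (\<Sum>i<K. ins i + R * ql i) - R * card L" .
  \<comment> \<open>Outside \<open>L\<close> a cluster counts 1 towards \<open>K\<close>, and the
    cover has at least one component there, so these clusters are paid for by
    \<open>qs\<close>.\<close>
  have "real K \<le> (\<Sum>r\<in>P. real (E r + 1))" using K by (simp only: of_nat_sum[symmetric] of_nat_le_iff)
  also have "\<dots> = (\<Sum>r\<in>L. real (E r + 1)) + (\<Sum>r\<in>P-L. real (E r + 1))"
    using sum.subset_diff[OF L(1) P(1)] by (simp add: add.commute)
  also have "(\<Sum>r\<in>P-L. real (E r + 1)) \<le> (\<Sum>r\<in>P-L. \<Sum>i<K. ?q i r)"
  proof (rule sum_mono)
    fix r assume r: "r \<in> P - L"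
    have "C r \<subseteq> V" "C r \<noteq> {}" using r P by auto
    then show "real (E r + 1) \<le> (\<Sum>i<K. ?q i r)" using sum_parts_ge_1[of "C r"] L(2)[OF r] by simp
  qed
  also have "\<dots> = (\<Sum>i<K. qs i)" unfolding qs_def by (rule sum.swap)
  finally have EL: "real K - (\<Sum>i<K. qs i) \<le> (\<Sum>r\<in>L. real (E r + 1))" by simp
  have "(\<Sum>r\<in>L. w r - (R + l) * E r - l) = (\<Sum>r\<in>L. w r) + R * card L - (R + l) * (\<Sum>r\<in>L. real (E r + 1))"
    by (simp add: sum.distrib sum_subtractf sum_distrib_left distrib_left distrib_right mult.commute)
  also have "\<dots> \<le> (\<Sum>i<K. ins i + R * ql i) - (R + l) * (\<Sum>r\<in>L. real (E r + 1))"
    using wL by simp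
  also have "\<dots> \<le> (\<Sum>i<K. ins i + R * ql i) - (R + l) * (real K - (\<Sum>i<K. qs i))"
    using mult_left_mono[OF EL, of "R + l"] l by simp
  also have "\<dots> = (\<Sum>i<K. ins i + R * ql i - (R + l) + (R + l) * qs i)"
    by (simp add: sum.distrib sum_subtractf sum_distrib_left right_diff_distrib mult.commute)
  finally have main: "(\<Sum>r\<in>L. w r - (R + l) * E r - l)
    \<le> (\<Sum>i<K. ins i + R * ql i - (R + l) + (R + l) * qs i)" .
  \<comment> \<open>The global bound is now a sum over trees; what remains is to compare the share
    of a single tree with its excess over \<open>l\<close>.\<close>
  have tree: "(R - l) * (ins i + R * ql i - (R + l) + (R + l) * qs i)
      \<le> (R + l) * max 0 (sum (edge_length d) (F i) - l)" if i: "i < K" for i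
  proof -
    let ?w = "sum (edge_length d) (F i)"
    define I where "I = (\<Union>r\<in>P. inside (F i) (C r))"
    define x where "x = card (F i - I)"
    have IF: "I \<subseteq> F i" by (auto simp: I_def inside_def)
    have disj: "inside (F i) (C r) \<inter> inside (F i) (C s) = {}" if "r \<in> P" "s \<in> P" "r \<noteq> s" for r s
    proof (rule ccontr)
      assume "\<not> ?thesis"
      then obtain f where f: "f \<in> F i" "f \<subseteq> C r" "f \<subseteq> C s" by (auto simp: inside_def)
      moreover have "f \<noteq> {}" using f pairs[OF i] by auto
      ultimately show False using P(4)[OF that] by blast
    qed
    have cardI: "card I = (\<Sum>r\<in>P. card (inside (F i) (C r)))"
      unfolding I_def by (rule card_UN_disjoint) (use P finF[OF i] disj in auto)
    have sumI: "sum (edge_length d) I = (\<Sum>r\<in>P. ?iw i r)"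
      unfolding I_def inside_weight_def by (rule sum.UNION_disjoint) (use P finF[OF i] disj in auto)
    have "card (U i) = (\<Sum>r\<in>P. card (U i \<inter> C r))"
    proof -
      have "U i = (\<Union>r\<in>P. U i \<inter> C r)" using P(3) UV[OF i] by auto
      then have "card (U i) = card (\<Union>r\<in>P. U i \<inter> C r)" by simp
      also have "\<dots> = (\<Sum>r\<in>P. card (U i \<inter> C r))"
      proof (rule card_UN_disjoint)
        show "\<forall>r\<in>P. \<forall>s\<in>P. r \<noteq> s \<longrightarrow> U i \<inter> C r \<inter> (U i \<inter> C s) = {}" using P(4) by blast
      qed (use P finU[OF i] in auto)
      finally show ?thesis .
    qed
    then have "(\<Sum>r\<in>P. ?q i r) = real (card (U i)) - card I"
      by (simp add: parts_def sum_subtractf cardI)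
    moreover have "card (F i) = card I + x"
      unfolding x_def using IF finF[OF i] by (simp add: card_Diff_subset finite_subset card_mono)
    \<comment> \<open>Deleting the \<open>x\<close> crossing edges of a tree leaves
      \<open>x + 1\<close> components, obtained here purely by counting.\<close>
    ultimately have "(\<Sum>r\<in>P. ?q i r) = x + 1" using card_F[OF i] by simp
    then have q: "ql i + qs i = x + 1"
      unfolding ql_def qs_def using sum.subset_diff[OF L(1) P(1), of "?q i"] by simp
    have long: "R \<le> edge_length d f" if f: "f \<in> F i - I" for f
    proof -
      obtain u v where uv: "f = {u, v}" "u \<in> U i" "v \<in> U i" using f pairs[OF i] by auto
      obtain r s where rs: "r \<in> P" "u \<in> C r" "s \<in> P" "v \<in> C s" using uv UV[OF i] P(3) by blast
      have "r \<noteq> s" using rs f uv by (auto simp: I_def inside_def)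
      then show ?thesis using far rs uv edge_length_doubleton[OF metric] by metis
    qed
    have "?w = sum (edge_length d) I + sum (edge_length d) (F i - I)"
      using sum.subset_diff[OF IF finF[OF i]] by (simp add: add.commute)
    moreover have "R * x \<le> sum (edge_length d) (F i - I)"
      unfolding x_def using sum_bounded_below[of "F i - I" R "edge_length d"] long by (simp add: mult.commute)
    moreover have "ins i \<le> sum (edge_length d) I"
      unfolding sumI ins_def by (rule sum_mono2) (use P L inside_weight_nonneg[OF i] in auto)
    ultimately have w: "ins i + R * x \<le> ?w" by simp
    have ins0: "0 \<le> ins i" unfolding ins_def by (rule sum_nonneg) (use inside_weight_nonneg[OF i] in auto)
    have ql0: "0 \<le> ql i" unfolding ql_def by (rule sum_nonneg) (use parts_nonneg[OF i] in auto)
    have qs0: "qs i = 0 \<or> 1 \<le> qs i"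
    proof (cases "\<exists>r\<in>P - L. C r \<inter> U i \<noteq> {}")
      case True
      then obtain r where r: "r \<in> P - L" "C r \<inter> U i \<noteq> {}" by blast
      have "1 \<le> ?q i r" using r parts_cases[OF i, of "C r"] by auto
      also have "\<dots> \<le> qs i" unfolding qs_def
        by (rule member_le_sum) (use r P parts_nonneg[OF i] in auto)
      finally show ?thesis by simp
    next
      case False
      have "?q i r = 0" if "r \<in> P - L" for r
        using False that parts_cases[OF i, of "C r"] by auto
      then show ?thesis by (simp add: qs_def)
    qed
    have insz: "ins i = 0" if "ql i = 0"
    proof -
      have "?q i r = 0" if "r \<in> L" for r
        using that \<open>ql i = 0\<close> finL parts_nonneg[OF i] unfolding ql_def
        by (simp add: sum_nonneg_eq_0_iff)
      then have "?iw i r = 0" if "r \<in> L" for r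
        using that parts_cases[OF i, of "C r"] by force
      then show ?thesis by (simp add: ins_def)
    qed
    show ?thesis
    \<comment> \<open>Without crossing edges the tree lies in one cluster: its share is
      \<open>ins i - l\<close> if that cluster is in \<open>L\<close>, and 0 otherwise.\<close>
    proof (cases "x = 0")
      case True
      from qs0 show ?thesis
      proof
        assume "qs i = 0"
        then have "(R - l) * (ins i + R * ql i - (R + l) + (R + l) * qs i) = (R - l) * (ins i - l)"
          using q True by simp
        also have "\<dots> \<le> (R - l) * max 0 (?w - l)" using w True l by (intro mult_left_mono) auto
        also have "\<dots> \<le> (R + l) * max 0 (?w - l)" using l by (intro mult_right_mono) auto
        finally show ?thesis .
      next
        assume "1 \<le> qs i"
        then have "ql i = 0" "qs i = 1" using q True ql0 by auto
        then show ?thesis using insz l by simp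
      qed
    next
      case False
      then have x1: "1 \<le> real x" by simp
      have "ins i + R * ql i - (R + l) + (R + l) * qs i = ins i + R * (ql i + qs i - 1) - l + l * qs i"
        by (simp add: algebra_simps)
      also have "\<dots> \<le> ins i + R * x - l + l * (x + 1)"
        using q ql0 l mult_left_mono[of "qs i" "x + 1" l] by simp
      also have "\<dots> \<le> ?w + l * x" using w by (simp add: algebra_simps)
      finally have "(R - l) * (ins i + R * ql i - (R + l) + (R + l) * qs i) \<le> (R - l) * (?w + l * x)"
        using l by (intro mult_left_mono) auto
      also have "\<dots> \<le> (R + l) * (?w - l)"
      proof -
        have "R * x \<le> ?w" using w ins0 by simp
        \<comment> \<open>The slack splits into two nonnegative terms; both vanish for a tree that
          consists of one crossing edge of length \<open>R\<close>.\<close>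
        then have "0 \<le> 2 * l * (?w - R * x) + l * (R + l) * (real x - 1)" using l x1 by simp
        also have "\<dots> = (R + l) * (?w - l) - (R - l) * (?w + l * x)" by (simp add: algebra_simps)
        finally show ?thesis by simp
      qed
      also have "\<dots> \<le> (R + l) * max 0 (?w - l)" using l by (intro mult_left_mono) auto
      finally show ?thesis .
    qed
  qed
  have "(R - l) * (\<Sum>r\<in>L. w r - (R + l) * E r - l)
      \<le> (R - l) * (\<Sum>i<K. ins i + R * ql i - (R + l) + (R + l) * qs i)"
    using main l by (intro mult_left_mono) auto
  also have "\<dots> \<le> (R + l) * (\<Sum>i<K. max 0 (sum (edge_length d) (F i) - l))"
    unfolding sum_distrib_left by (rule sum_mono) (use tree in auto)
  finally show ?thesis .
qed

end


section \<open>Tours and clusterings\<close>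

fun path_length :: "('a \<Rightarrow> 'a \<Rightarrow> real) \<Rightarrow> 'a list \<Rightarrow> real" where
  "path_length d (x # y # zs) = d x y + path_length d (y # zs)"
| "path_length d _ = 0"

lemma path_length_append:
  "xs \<noteq> [] \<Longrightarrow> ys \<noteq> [] \<Longrightarrow>
    path_length d (xs @ ys) = path_length d xs + d (last xs) (hd ys) + path_length d ys"
proof (induction d xs rule: path_length.induct)
  case ("2_2" d v)
  then show ?case by (cases ys) auto
qed auto

lemma path_length_nonneg: "(\<And>x y. 0 \<le> d x y) \<Longrightarrow> 0 \<le> path_length d xs"
  by (induction d xs rule: path_length.induct) auto

text \<open>\<open>cur\<close> is the open piece. It is closed when the next edge would make it
  longer than \<open>B\<close>, and that edge then belongs to no piece. The accumulator mirrors the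
  state of the program that performs the cut.\<close>

fun cut :: "('a \<Rightarrow> 'a \<Rightarrow> real) \<Rightarrow> real \<Rightarrow> 'a list \<Rightarrow> 'a list \<Rightarrow> 'a list list" where
  "cut d B cur [] = [cur]"
| "cut d B cur (v # vs) =
    (if path_length d cur + d (last cur) v \<le> B then cut d B (cur @ [v]) vs
     else cur # cut d B [v] vs)"

lemma cut_nonempty [simp]: "cut d B cur vs \<noteq> []"
  by (induction d B cur vs rule: cut.induct) auto

lemma length_cut_ge_1: "1 \<le> length (cut d B cur vs)"
  by (simp add: Suc_leI)

lemma concat_cut: "concat (cut d B cur vs) = cur @ vs"
  by (induction d B cur vs rule: cut.induct) auto

lemma cut_pieces_nonempty: "cur \<noteq> [] \<Longrightarrow> p \<in> set (cut d B cur vs) \<Longrightarrow> p \<noteq> []"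
  by (induction d B cur vs rule: cut.induct) (auto split: if_splits)

lemma cut_piece_le:
  "cur \<noteq> [] \<Longrightarrow> path_length d cur \<le> B \<Longrightarrow> 0 \<le> B \<Longrightarrow> p \<in> set (cut d B cur vs) \<Longrightarrow>
    path_length d p \<le> B"
  by (induction d B cur vs rule: cut.induct) (auto simp: path_length_append split: if_splits)

lemma sum_cut_le:
  "(\<And>x y. 0 \<le> d x y) \<Longrightarrow> cur \<noteq> [] \<Longrightarrow>
    sum_list (map (path_length d) (cut d B cur vs)) \<le> path_length d (cur @ vs)"
  by (induction d B cur vs rule: cut.induct) (auto simp: path_length_append add_increasing)

text \<open>Each piece but the last, together with the edge dropped behind it, is longer than
  \<open>B\<close>.\<close>

lemma length_cut_le:
  "(\<And>x y. 0 \<le> d x y) \<Longrightarrow> cur \<noteq> [] \<Longrightarrow>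
    B * (real (length (cut d B cur vs)) - 1) \<le> path_length d (cur @ vs)"
proof (induction d B cur vs rule: cut.induct)
  case (2 d B cur v vs)
  then show ?case by (auto simp: path_length_append algebra_simps)
qed (simp add: path_length_nonneg)

lemma cut_single:
  "(\<And>x y. 0 \<le> d x y) \<Longrightarrow> cur \<noteq> [] \<Longrightarrow> path_length d (cur @ vs) \<le> B \<Longrightarrow>
    length (cut d B cur vs) = 1"
proof (induction d B cur vs rule: cut.induct)
  case (2 d B cur v vs)
  then have "path_length d cur + d (last cur) v \<le> B"
    using path_length_nonneg[of d "v # vs"] by (simp add: path_length_append)
  then show ?case using 2 by simp
qed simp

text \<open>A cycle of the successor map, listed from an arbitrary start. A single point with
  \<open>nx v = v\<close> is allowed: this is the situation before any merge.\<close>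

definition tour :: "('a \<Rightarrow> 'a) \<Rightarrow> 'a list \<Rightarrow> bool" where
  "tour nx xs \<longleftrightarrow> distinct xs \<and> xs \<noteq> [] \<and> map nx xs = rotate1 xs"

lemma tour_rotate: "tour nx xs \<Longrightarrow> tour nx (rotate m xs)"
  by (simp add: tour_def rotate_map[symmetric] rotate1_rotate_swap)

lemma tour_hd:
  assumes "tour nx xs" "r \<in> set xs"
  obtains ys where "tour nx ys" "set ys = set xs" "hd ys = r"
proof -
  obtain i where i: "i < length xs" "xs ! i = r" using assms(2) by (auto simp: in_set_conv_nth)
  then have "hd (rotate i xs) = r"
    using assms(1) by (simp add: hd_rotate_conv_nth tour_def)
  then show ?thesis using that[OF tour_rotate[OF assms(1)]] by (metis set_rotate)
qed

lemma tour_last: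
  assumes "tour nx xs" "r \<in> set xs"
  obtains ys where "tour nx (ys @ [r])" "set (ys @ [r]) = set xs"
proof -
  obtain zs where zs: "tour nx zs" "set zs = set xs" "hd zs = r" using tour_hd[OF assms] .
  then obtain ys where "zs = r # ys" by (cases zs) (auto simp: tour_def)
  then have *: "rotate 1 zs = ys @ [r]" by simp
  then have "set (ys @ [r]) = set xs" using zs(2) by (metis set_rotate)
  then show ?thesis using that tour_rotate[OF zs(1), of 1] * by simp
qed

text \<open>With \<open>u\<close> and \<open>v\<close> listed last, both cycles are cut open behind
  these points. After the exchange \<open>u\<close> continues with the head of the second list and
  \<open>v\<close> with the head of the first, so the concatenation is the new cycle.\<close>

lemma tour_merge:
  assumes xs: "tour nx (xs @ [u])" and ys: "tour nx (ys @ [v])"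
    and disj: "set (xs @ [u]) \<inter> set (ys @ [v]) = {}"
  shows "tour (nx(u := nx v, v := nx u)) (xs @ [u] @ ys @ [v])"
proof -
  let ?nx = "nx(u := nx v, v := nx u)"
  have "map ?nx xs = map nx xs" "map ?nx ys = map nx ys" "u \<noteq> v"
    using xs ys disj by (auto simp: tour_def)
  moreover obtain x xs' where x: "xs @ [u] = x # xs'" by (cases "xs @ [u]") auto
  moreover obtain y ys' where y: "ys @ [v] = y # ys'" by (cases "ys @ [v]") auto
  moreover have "map nx (xs @ [u]) = rotate1 (x # xs')" "map nx (ys @ [v]) = rotate1 (y # ys')"
    using xs ys x y unfolding tour_def by simp_all
  then have "map nx xs = xs'" "nx u = x" "map nx ys = ys'" "nx v = y" by auto
  moreover have "rotate1 (xs @ [u] @ ys @ [v]) = xs' @ y # ys' @ [x]"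
  proof -
    have "xs @ [u] @ ys @ [v] = x # xs' @ y # ys'"
      using x y by (metis append.assoc append_Cons)
    then show ?thesis by simp
  qed
  moreover have "map ?nx (xs @ [u] @ ys @ [v]) = map ?nx xs @ [nx v] @ map ?nx ys @ [nx u]"
    using \<open>u \<noteq> v\<close> by simp
  ultimately have "map ?nx (xs @ [u] @ ys @ [v]) = rotate1 (xs @ [u] @ ys @ [v])"
    by (metis append_Cons append_Nil)
  then show ?thesis using xs ys disj by (auto simp: tour_def)
qed

lemma tour_nth:
  assumes "tour nx xs" "i < length xs"
  shows "nx (xs ! i) = xs ! (Suc i mod length xs)"
  using assms by (metis length_map nth_map nth_rotate1 tour_def)

text \<open>The path omits only the closing edge of the tour.\<close>

lemma path_length_le_tour:
  assumes nonneg: "\<And>x y. 0 \<le> d x y" and "tour nx xs"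
  shows "path_length d xs \<le> (\<Sum>v\<in>set xs. d v (nx v))"
proof -
  \<comment> \<open>An arbitrary endpoint \<open>z\<close> replaces the head of the list, which
    would change in the induction.\<close>
  have gen: "path_length d ys + d (last ys) z = sum_list (map (\<lambda>v. d v (nx v)) ys)"
    if "map nx ys = tl ys @ [z]" "ys \<noteq> []" for ys z
    using that
  proof (induction ys)
    case (Cons y ys)
    then show ?case by (cases ys) auto
  qed simp
  have "map nx xs = tl xs @ [hd xs]" "xs \<noteq> []" "distinct xs"
    using assms(2) unfolding tour_def by (cases xs; simp)+
  from gen[OF this(1,2)] this(3) have "path_length d xs + d (last xs) (hd xs) = (\<Sum>v\<in>set xs. d v (nx v))"
    by (simp add: sum_list_distinct_conv_sum_set)
  then show ?thesis using nonneg[of "last xs" "hd xs"] by simp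
qed

section \<open>Clusters, their representatives and merges\<close>

definition reps :: "nat \<Rightarrow> (nat \<Rightarrow> nat) \<Rightarrow> nat set" where
  "reps n cm = {r. r < n \<and> cm r = r}"

definition cluster :: "nat \<Rightarrow> (nat \<Rightarrow> nat) \<Rightarrow> nat \<Rightarrow> nat set" where
  "cluster n cm r = {v. v < n \<and> cm v = r}"

lemma finite_reps [simp]: "finite (reps n cm)"
  by (simp add: reps_def)

lemma finite_cluster [simp]: "finite (cluster n cm r)"
  by (simp add: cluster_def)

lemma rep_in_cluster: "r \<in> reps n cm \<Longrightarrow> r \<in> cluster n cm r"
  by (simp add: reps_def cluster_def)

lemma cluster_disjoint: "r \<noteq> s \<Longrightarrow> cluster n cm r \<inter> cluster n cm s = {}"
  by (auto simp: cluster_def)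

text \<open>Here \<open>w r\<close> is the total length of the edges that formed the cluster of \<open>r\<close>, \<open>e\<close> the
  length of the last one.\<close>

definition clustering ::
  "nat \<Rightarrow> (nat \<Rightarrow> nat \<Rightarrow> real) \<Rightarrow> (nat \<Rightarrow> nat) \<Rightarrow> (nat \<Rightarrow> nat) \<Rightarrow> real \<Rightarrow> real \<Rightarrow> (nat \<Rightarrow> real) \<Rightarrow> bool"
where
  "clustering n d nx cm R e w \<longleftrightarrow>
     (\<forall>v<n. cm v \<in> reps n cm) \<and>
     (\<forall>r\<in>reps n cm. (\<exists>xs. tour nx xs \<and> set xs = cluster n cm r) \<and>
        (\<Sum>v\<in>cluster n cm r. d v (nx v)) \<le> 2 * w r \<and>
        cover_bound {..<n} d (cluster n cm r) (w r) R \<and>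
        w r \<le> (real (card (cluster n cm r)) - 1) * e) \<and>
     (\<forall>u<n. \<forall>v<n. cm u \<noteq> cm v \<longrightarrow> R \<le> d u v) \<and> 0 \<le> e \<and> e \<le> R"

lemma Union_cluster:
  assumes "\<forall>v<n. cm v \<in> reps n cm"
  shows "(\<Union>r\<in>reps n cm. cluster n cm r) = {..<n}"
  using assms by (auto simp: cluster_def)

lemma clustering_init:
  assumes "Metric_space {..<n} d" "\<And>v. v < n \<Longrightarrow> cm v = v" "\<And>v. v < n \<Longrightarrow> nx v = v"
  shows "clustering n d nx cm 0 0 (\<lambda>_. 0)" "reps n cm = {..<n}"
proof -
  have cl: "cluster n cm r = {r}" if "r < n" for r
    using that assms(2) by (auto simp: cluster_def)
  show reps: "reps n cm = {..<n}" using assms(2) by (auto simp: reps_def)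
  show "clustering n d nx cm 0 0 (\<lambda>_. 0)"
    unfolding clustering_def reps
  proof (intro conjI ballI)
    fix r assume r: "r \<in> {..<n}"
    show "\<exists>xs. tour nx xs \<and> set xs = cluster n cm r"
      by (rule exI[of _ "[r]"]) (use r cl assms(3) in \<open>auto simp: tour_def\<close>)
    show "(\<Sum>v\<in>cluster n cm r. d v (nx v)) \<le> 2 * 0"
      using r cl assms(3) Metric_space.zero[OF assms(1), of r r] by simp
    show "cover_bound {..<n} d (cluster n cm r) 0 0"
      using cover_bound_singleton[of r "{..<n}" 0 d] r cl by simp
  qed (use assms Metric_space.nonneg[OF assms(1)] cl in auto)
qed

text \<open>\<open>R\<close> enters only as an upper bound for \<open>e\<close>, as a lower bound
  for crossing distances, and through the cover bounds, which weaken as it grows. This serves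
  doublings and also the preparation of a merge.\<close>

lemma clustering_raise:
  assumes "clustering n d nx cm R e w" "R \<le> R'"
    and "\<And>u v. u < n \<Longrightarrow> v < n \<Longrightarrow> cm u \<noteq> cm v \<Longrightarrow> R' \<le> d u v"
  shows "clustering n d nx cm R' e w"
proof -
  have "cover_bound {..<n} d (cluster n cm r) (w r) R'" if "r \<in> reps n cm" for r
    by (rule cover_bound_mono[of _ _ _ _ R])
      (use assms that rep_in_cluster[OF that] in \<open>auto simp: clustering_def cluster_def\<close>)
  then show ?thesis using assms unfolding clustering_def by auto
qed

definition merged :: "nat \<Rightarrow> (nat \<Rightarrow> nat) \<Rightarrow> nat \<Rightarrow> nat \<Rightarrow> nat \<Rightarrow> nat" where
  "merged n cm u v = (\<lambda>x. if x < n \<and> cm x = cm v then cm u else cm x)"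

lemma merged_reps:
  assumes "\<forall>v<n. cm v \<in> reps n cm" "u < n" "v < n" "cm u \<noteq> cm v"
  shows "reps n (merged n cm u v) = reps n cm - {cm v}"
    and "\<forall>x<n. merged n cm u v x \<in> reps n (merged n cm u v)"
    and "cluster n (merged n cm u v) (cm u) = cluster n cm (cm u) \<union> cluster n cm (cm v)"
    and "\<And>r. r \<noteq> cm u \<Longrightarrow> r \<noteq> cm v \<Longrightarrow> cluster n (merged n cm u v) r = cluster n cm r"
proof -
  have idem: "cm x < n" "cm (cm x) = cm x" if "x < n" for x
    using assms(1) that by (auto simp: reps_def)
  have 1: "merged n cm u v r = r \<longleftrightarrow> cm r = r \<and> r \<noteq> cm v" if "r < n" for r
    using idem[OF assms(2)] idem[OF assms(3)] assms(4) that unfolding merged_def by metis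
  then show r: "reps n (merged n cm u v) = reps n cm - {cm v}"
    unfolding reps_def by blast
  show "\<forall>x<n. merged n cm u v x \<in> reps n (merged n cm u v)"
  proof (intro allI impI)
    fix x assume "x < n"
    then show "merged n cm u v x \<in> reps n (merged n cm u v)"
      unfolding r using assms by (cases "cm x = cm v") (auto simp: merged_def)
  qed
  show "cluster n (merged n cm u v) (cm u) = cluster n cm (cm u) \<union> cluster n cm (cm v)"
    unfolding cluster_def merged_def by auto
  show "cluster n (merged n cm u v) r = cluster n cm r" if "r \<noteq> cm u" "r \<noteq> cm v" for r
    using that unfolding cluster_def merged_def by auto
qed

text \<open>By the triangle inequality across \<open>uv\<close> in both directions, the exchange of
  successors lengthens the tours by at most \<open>2 * d u v\<close>, in step with the growth of
  \<open>w\<close>. The cover bounds of both clusters are lifted to \<open>d u v\<close> beforehand,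
  since merging them requires a common radius.\<close>

lemma clustering_merge:
  assumes metric: "Metric_space {..<n} d" and C: "clustering n d nx cm R e w"
    and uv: "u < n" "v < n" "cm u \<noteq> cm v"
    and min: "\<And>x y. x < n \<Longrightarrow> y < n \<Longrightarrow> cm x \<noteq> cm y \<Longrightarrow> d u v \<le> d x y"
  shows "clustering n d (nx(u := nx v, v := nx u)) (merged n cm u v) (d u v) (d u v)
    (w(cm u := w (cm u) + w (cm v) + d u v))"
proof -
  interpret Metric_space "{..<n}" d by (rule metric)
  let ?nx = "nx(u := nx v, v := nx u)" and ?cm = "merged n cm u v"
  let ?w = "w(cm u := w (cm u) + w (cm v) + d u v)"
  let ?A = "cluster n cm (cm u)" and ?B = "cluster n cm (cm v)"
  have cmr: "\<forall>v<n. cm v \<in> reps n cm" using C by (simp add: clustering_def)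
  note mr = merged_reps[OF cmr uv]
  have Re: "R \<le> d u v" "0 \<le> e" "e \<le> d u v" using C uv unfolding clustering_def by force+
  have "clustering n d nx cm (d u v) e w" by (rule clustering_raise[OF C Re(1) min])
  then have cl: "(\<exists>xs. tour nx xs \<and> set xs = cluster n cm r)"
        "(\<Sum>v\<in>cluster n cm r. d v (nx v)) \<le> 2 * w r"
        "cover_bound {..<n} d (cluster n cm r) (w r) (d u v)"
        "w r \<le> (real (card (cluster n cm r)) - 1) * e" if "r \<in> reps n cm" for r
    using that by (auto simp: clustering_def)
  have cl4: "w r \<le> (real (card (cluster n cm r)) - 1) * d u v" if r: "r \<in> reps n cm" for r
  proof -
    have "card (cluster n cm r) \<ge> 1"
      using rep_in_cluster[OF r] by (metis One_nat_def Suc_leI card_gt_0_iff empty_iff finite_cluster)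
    then have "(real (card (cluster n cm r)) - 1) * e \<le> (real (card (cluster n cm r)) - 1) * d u v"
      using Re by (intro mult_left_mono) auto
    then show ?thesis using cl(4)[OF r] by simp
  qed
  have ab: "cm u \<in> reps n cm" "cm v \<in> reps n cm" using cmr uv by auto
  have uA: "u \<in> ?A" "v \<in> ?B" using uv by (auto simp: cluster_def)
  have AB: "?A \<inter> ?B = {}" by (rule cluster_disjoint[OF uv(3)])
  have merged_cluster: "(\<exists>xs. tour ?nx xs \<and> set xs = ?A \<union> ?B) \<and>
        (\<Sum>v\<in>?A \<union> ?B. d v (?nx v)) \<le> 2 * (w (cm u) + w (cm v) + d u v) \<and>
        cover_bound {..<n} d (?A \<union> ?B) (w (cm u) + w (cm v) + d u v) (d u v) \<and>
        w (cm u) + w (cm v) + d u v \<le> (real (card (?A \<union> ?B)) - 1) * d u v"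
  proof (intro conjI)
    obtain xs where xs: "tour nx (xs @ [u])" "set (xs @ [u]) = ?A"
      using cl(1)[OF ab(1)] tour_last uA by metis
    obtain ys where ys: "tour nx (ys @ [v])" "set (ys @ [v]) = ?B"
      using cl(1)[OF ab(2)] tour_last uA by metis
    show "\<exists>xs. tour ?nx xs \<and> set xs = ?A \<union> ?B"
      using tour_merge[OF xs(1) ys(1)] AB xs(2) ys(2)
      by (intro exI[of _ "xs @ [u] @ ys @ [v]"]) auto
    have inV: "nx x < n" if "x \<in> set zs" "tour nx zs" "set zs \<subseteq> {..<n}" for x zs
      using that unfolding tour_def by (metis image_eqI image_set lessThan_iff set_rotate1 subsetD)
    have "nx u < n" "nx v < n"
      using inV[of u "xs @ [u]"] inV[of v "ys @ [v]"] xs ys by (auto simp: cluster_def)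
    then have swap: "d u (nx v) + d v (nx u) \<le> 2 * d u v + d u (nx u) + d v (nx v)"
      using triangle[of u v "nx v"] triangle[of v u "nx u"] commute[of u v] uv by simp
    have upd: "(\<Sum>x\<in>S. d x ((f(y := z)) x)) = (\<Sum>x\<in>S. d x (f x)) - d y (f y) + d y z"
      if "finite S" "y \<in> S" for S f y z
      using that by (simp add: sum.remove[of S y])
    have "(\<Sum>x\<in>?A \<union> ?B. d x (?nx x)) = (\<Sum>x\<in>?A. d x (?nx x)) + (\<Sum>x\<in>?B. d x (?nx x))"
      using AB by (simp add: sum.union_disjoint)
    also have "(\<Sum>x\<in>?A. d x (?nx x)) = (\<Sum>x\<in>?A. d x (nx x)) - d u (nx u) + d u (nx v)"
      unfolding upd[OF finite_cluster uA(1), symmetric]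
      by (rule sum.cong) (use uA AB in auto)
    also have "(\<Sum>x\<in>?B. d x (?nx x)) = (\<Sum>x\<in>?B. d x (nx x)) - d v (nx v) + d v (nx u)"
      unfolding upd[OF finite_cluster uA(2), symmetric]
      by (rule sum.cong) (use uA AB in auto)
    finally show "(\<Sum>v\<in>?A \<union> ?B. d v (?nx v)) \<le> 2 * (w (cm u) + w (cm v) + d u v)"
      using swap cl(2)[OF ab(1)] cl(2)[OF ab(2)] by (simp del: fun_upd_apply)
    show "cover_bound {..<n} d (?A \<union> ?B) (w (cm u) + w (cm v) + d u v) (d u v)"
      by (rule cover_bound_merge[OF cl(3)[OF ab(1)] cl(3)[OF ab(2)] AB])
        (use min uv in \<open>auto simp: cluster_def\<close>)
    have "card (?A \<union> ?B) = card ?A + card ?B" using AB by (simp add: card_Un_disjoint)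
    then show "w (cm u) + w (cm v) + d u v \<le> (real (card (?A \<union> ?B)) - 1) * d u v"
      using cl4[OF ab(1)] cl4[OF ab(2)] by (simp add: algebra_simps)
  qed
  have other: "(\<exists>xs. tour ?nx xs \<and> set xs = cluster n cm r) \<and>
        (\<Sum>v\<in>cluster n cm r. d v (?nx v)) \<le> 2 * w r" if r: "r \<in> reps n cm" "r \<noteq> cm u" "r \<noteq> cm v" for r
  proof -
    have nin: "u \<notin> cluster n cm r" "v \<notin> cluster n cm r" using r by (auto simp: cluster_def)
    obtain xs where xs: "tour nx xs" "set xs = cluster n cm r" using cl(1)[OF r(1)] by blast
    have "map ?nx xs = map nx xs" using nin xs(2) by auto
    then have "tour ?nx xs" using xs(1) unfolding tour_def by metis
    moreover have "(\<Sum>v\<in>cluster n cm r. d v (?nx v)) = (\<Sum>v\<in>cluster n cm r. d v (nx v))"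
      by (rule sum.cong) (use nin in auto)
    ultimately show ?thesis using xs(2) cl(2)[OF r(1)] by auto
  qed
  show ?thesis
    unfolding clustering_def
  proof (intro conjI ballI)
    fix r assume r: "r \<in> reps n ?cm"
    then have rc: "r \<in> reps n cm" "r \<noteq> cm v" using mr(1) by auto
    show "\<exists>xs. tour ?nx xs \<and> set xs = cluster n ?cm r"
      "(\<Sum>v\<in>cluster n ?cm r. d v (?nx v)) \<le> 2 * ?w r"
      "cover_bound {..<n} d (cluster n ?cm r) (?w r) (d u v)"
      "?w r \<le> (real (card (cluster n ?cm r)) - 1) * d u v"
      using merged_cluster other[OF rc(1) _ rc(2)] cl(3)[OF rc(1)] cl4[OF rc(1)] mr(3) mr(4)[OF _ rc(2)]
      by (cases "r = cm u"; simp del: fun_upd_apply add: fun_upd_same fun_upd_other)+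
  next
    show "\<forall>x<n. \<forall>y<n. ?cm x \<noteq> ?cm y \<longrightarrow> d u v \<le> d x y"
    proof (intro allI impI)
      fix x y assume "x < n" "y < n" "?cm x \<noteq> ?cm y"
      then show "d u v \<le> d x y" by (intro min) (auto simp: merged_def split: if_splits)
    qed
  qed (use mr(2) nonneg in auto)
qed


section \<open>Cutting the tours\<close>

text \<open>The limit \<open>m\<close> on the representatives makes partial output expressible:
  \<open>m = n\<close> is the complete result, smaller values describe the output loop on its
  way.\<close>

definition pieces ::
  "nat \<Rightarrow> (nat \<Rightarrow> nat \<Rightarrow> real) \<Rightarrow> (nat \<Rightarrow> nat) \<Rightarrow> (nat \<Rightarrow> nat list) \<Rightarrow> real \<Rightarrow> nat \<Rightarrow> nat list list"
where
  "pieces n d cm cy B m =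
     concat (map (\<lambda>r. cut d B [r] (tl (cy r))) (filter (\<lambda>r. cm r = r) [0..<m]))"

text \<open>Requiring \<open>hd (cy r) = r\<close> fixes where each cycle is opened, namely where
  the program starts its walk.\<close>

definition tours :: "nat \<Rightarrow> (nat \<Rightarrow> nat) \<Rightarrow> (nat \<Rightarrow> nat) \<Rightarrow> (nat \<Rightarrow> nat list) \<Rightarrow> bool" where
  "tours n nx cm cy \<longleftrightarrow>
     (\<forall>r\<in>reps n cm. tour nx (cy r) \<and> set (cy r) = cluster n cm r \<and> hd (cy r) = r)"

lemma clustering_tours:
  assumes "clustering n d nx cm R e w"
  obtains cy where "tours n nx cm cy"
proof -
  have "\<forall>r\<in>reps n cm. \<exists>ys. tour nx ys \<and> set ys = cluster n cm r \<and> hd ys = r"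
    using assms rep_in_cluster unfolding clustering_def by (metis tour_hd)
  then show ?thesis using that unfolding tours_def by metis
qed

lemma tours_Cons:
  assumes "tours n nx cm cy" "r \<in> reps n cm"
  shows "cy r = r # tl (cy r)"
  using assms unfolding tours_def tour_def by (metis list.collapse)

lemma sum_list_pieces:
  "sum_list (map f (pieces n d cm cy B n)) = (\<Sum>r\<in>reps n cm. sum_list (map f (cut d B [r] (tl (cy r)))))"
proof -
  have set: "set (filter (\<lambda>r. cm r = r) [0..<n]) = reps n cm" by (auto simp: reps_def)
  have "sum_list (map f (concat (map g xs))) = sum_list (map (\<lambda>r. sum_list (map f (g r))) xs)" for g :: "nat \<Rightarrow> nat list list" and xs
    by (induction xs) auto
  then have "sum_list (map f (pieces n d cm cy B n))
      = sum_list (map (\<lambda>r. sum_list (map f (cut d B [r] (tl (cy r))))) (filter (\<lambda>r. cm r = r) [0..<n]))"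
    unfolding pieces_def .
  also have "\<dots> = (\<Sum>r\<in>reps n cm. sum_list (map f (cut d B [r] (tl (cy r)))))"
    unfolding set[symmetric] by (rule sum_list_distinct_conv_sum_set) simp
  finally show ?thesis .
qed

lemma length_pieces:
  "length (pieces n d cm cy B n) = (\<Sum>r\<in>reps n cm. length (cut d B [r] (tl (cy r))))"
  using sum_list_pieces[of "\<lambda>_. 1::nat" n d cm cy B] by (simp add: sum_list_triv)

lemma set_pieces:
  "set (pieces n d cm cy B n) = (\<Union>r\<in>reps n cm. set (cut d B [r] (tl (cy r))))"
  by (auto simp: pieces_def reps_def)

lemma pieces_cover:
  assumes "tours n nx cm cy" "\<forall>v<n. cm v \<in> reps n cm"
  shows "(\<Union>p\<in>set (pieces n d cm cy B n). set p) = {..<n}"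
proof -
  have "(\<Union>p\<in>set (pieces n d cm cy B n). set p) = (\<Union>r\<in>reps n cm. \<Union>p\<in>set (cut d B [r] (tl (cy r))). set p)"
    by (simp add: set_pieces)
  also have "\<dots> = (\<Union>r\<in>reps n cm. set (concat (cut d B [r] (tl (cy r)))))"
    by simp
  also have "\<dots> = (\<Union>r\<in>reps n cm. cluster n cm r)"
  proof (rule SUP_cong)
    fix r assume r: "r \<in> reps n cm"
    have "concat (cut d B [r] (tl (cy r))) = cy r"
      using tours_Cons[OF assms(1) r] by (simp add: concat_cut)
    then show "set (concat (cut d B [r] (tl (cy r)))) = cluster n cm r"
      using assms(1) r unfolding tours_def by metis
  qed simp
  finally show ?thesis using Union_cluster[OF assms(2)] by simp
qed

lemma distinct_concat_member: "distinct (concat xss) \<Longrightarrow> xs \<in> set xss \<Longrightarrow> distinct xs"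
  by (induction xss) auto

lemma pieces_path:
  assumes "tours n nx cm cy" "p \<in> set (pieces n d cm cy B n)"
  shows "p \<noteq> []" "distinct p"
proof -
  obtain r where r: "r \<in> reps n cm" "p \<in> set (cut d B [r] (tl (cy r)))"
    using assms(2) by (auto simp: set_pieces)
  show "p \<noteq> []" using cut_pieces_nonempty[OF _ r(2)] by simp
  have "concat (cut d B [r] (tl (cy r))) = cy r"
    using tours_Cons[OF assms(1) r(1)] by (simp add: concat_cut)
  then have "distinct (concat (cut d B [r] (tl (cy r))))"
    using assms(1) r(1) unfolding tours_def tour_def by metis
  then show "distinct p" using r(2) by (rule distinct_concat_member)
qed

text \<open>For \<open>R = 0\<close> all pieces have length 0 and nothing has to be certified; this
  is the case before the first merge. \<open>E\<close> is left existential because it stems from the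
  cut of an earlier round, not from the current one.\<close>

definition certificate :: "nat \<Rightarrow> nat \<Rightarrow> (nat \<Rightarrow> nat) \<Rightarrow> real \<Rightarrow> (nat \<Rightarrow> real) \<Rightarrow> bool" where
  "certificate k n cm R w \<longleftrightarrow> R = 0 \<or>
     (\<exists>E. (\<forall>r\<in>reps n cm. 3 * R * real (E r) \<le> w r) \<and> k \<le> (\<Sum>r\<in>reps n cm. E r + 1))"

locale cut_clustering =
  fixes n :: nat and d nx cm R e w cy
  assumes metric: "Metric_space {..<n} d"
    and clustering: "clustering n d nx cm R e w"
    and tours: "tours n nx cm cy"
begin

lemma nonneg: "0 \<le> d x y"
  using Metric_space.nonneg[OF metric] .

lemma R_nonneg: "0 \<le> R"
  using clustering by (simp add: clustering_def)

abbreviation "B \<equiv> 12 * R"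

abbreviation "ps \<equiv> pieces n d cm cy B n"

abbreviation "cuts r \<equiv> cut d B [r] (tl (cy r))"

lemma tour_le:
  assumes "r \<in> reps n cm"
  shows "path_length d (cy r) \<le> 2 * w r"
proof -
  have "path_length d (cy r) \<le> (\<Sum>v\<in>set (cy r). d v (nx v))"
    by (rule path_length_le_tour) (use nonneg tours assms in \<open>auto simp: tours_def\<close>)
  also have "\<dots> \<le> 2 * w r" using tours assms clustering by (simp add: tours_def clustering_def)
  finally show ?thesis .
qed

lemma w_nonneg: "r \<in> reps n cm \<Longrightarrow> 0 \<le> w r"
  using tour_le[of r] path_length_nonneg[of d "cy r"] nonneg by simp

lemma cuts_path: "r \<in> reps n cm \<Longrightarrow> [r] @ tl (cy r) = cy r"
  using tours_Cons[OF tours] by simp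

lemma cuts_piece_le: "p \<in> set (cuts r) \<Longrightarrow> path_length d p \<le> B"
  by (rule cut_piece_le) (use R_nonneg in auto)

lemma cuts_sum_le: "r \<in> reps n cm \<Longrightarrow> sum_list (map (path_length d) (cuts r)) \<le> 2 * w r"
  using sum_cut_le[of d "[r]" B "tl (cy r)"] nonneg cuts_path tour_le[of r] by fastforce

lemma cuts_length_le: "r \<in> reps n cm \<Longrightarrow> 6 * R * (real (length (cuts r)) - 1) \<le> w r"
  using length_cut_le[of d "[r]" B "tl (cy r)"] nonneg cuts_path tour_le[of r] by fastforce

text \<open>\<open>E r\<close> is the number of cuts in the tour of \<open>r\<close>; each uses up
  \<open>12 * R\<close> of a length of at most \<open>2 * w r\<close>. The strict inequality leaves
  one unit that a merge may lose.\<close>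

lemma certificate_old:
  assumes "k < length ps"
  shows "\<exists>E. (\<forall>r\<in>reps n cm. 6 * R * real (E r) \<le> w r) \<and> k < (\<Sum>r\<in>reps n cm. E r + 1)"
proof (intro exI conjI ballI)
  fix r assume r: "r \<in> reps n cm"
  show "6 * R * real (length (cuts r) - 1) \<le> w r"
    using cuts_length_le[OF r] length_cut_ge_1[of d B "[r]" "tl (cy r)"] by (simp add: of_nat_diff)
next
  have "(\<Sum>r\<in>reps n cm. length (cuts r) - 1 + 1) = (\<Sum>r\<in>reps n cm. length (cuts r))"
    by (rule sum.cong) (use length_cut_ge_1 in auto)
  then show "k < (\<Sum>r\<in>reps n cm. length (cuts r) - 1 + 1)" using assms by (simp add: length_pieces)
qed

lemma certificate_double:
  assumes "k < length ps"
  shows "certificate k n cm (R + R) w"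
  using certificate_old[OF assms] unfolding certificate_def by (auto simp: less_imp_le)

text \<open>Adding \<open>E\<close> over the two clusters lowers \<open>\<Sum>(E + 1)\<close> by
  exactly one, since two summands 1 become one. The bound on \<open>d u v\<close> turns the factor
  \<open>6 * R\<close> into at least \<open>3 * d u v\<close>.\<close>

lemma certificate_merge:
  assumes "k < length ps" "u < n" "v < n" "cm u \<noteq> cm v" "d u v \<le> R + R"
  shows "certificate k n (merged n cm u v) (d u v) (w(cm u := w (cm u) + w (cm v) + d u v))"
proof -
  obtain E where E: "\<And>r. r \<in> reps n cm \<Longrightarrow> 6 * R * real (E r) \<le> w r" "k < (\<Sum>r\<in>reps n cm. E r + 1)"
    using certificate_old[OF assms(1)] by blast
  have E3: "3 * d u v * real (E r) \<le> w r" if "r \<in> reps n cm" for r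
  proof -
    have "3 * d u v * real (E r) \<le> 6 * R * real (E r)"
      using assms(5) by (intro mult_right_mono) auto
    then show ?thesis using E(1)[OF that] by linarith
  qed
  have cmr: "\<forall>v<n. cm v \<in> reps n cm" using clustering by (simp add: clustering_def)
  note mr = merged_reps[OF cmr assms(2-4)]
  have ab: "cm u \<in> reps n cm - {cm v}" "cm v \<in> reps n cm" using cmr assms by auto
  let ?E = "E(cm u := E (cm u) + E (cm v))"
  have "(\<Sum>r\<in>reps n cm. E r + 1) = (E (cm v) + 1) + ((E (cm u) + 1) + (\<Sum>r\<in>reps n cm - {cm v} - {cm u}. E r + 1))"
    using ab by (simp add: sum.remove[of "reps n cm" "cm v"] sum.remove[of "reps n cm - {cm v}" "cm u"])
  moreover have "(\<Sum>r\<in>reps n cm - {cm v}. ?E r + 1)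
      = (E (cm u) + E (cm v) + 1) + (\<Sum>r\<in>reps n cm - {cm v} - {cm u}. E r + 1)"
    using ab by (simp add: sum.remove[of "reps n cm - {cm v}" "cm u"])
  ultimately have "k \<le> (\<Sum>r\<in>reps n (merged n cm u v). ?E r + 1)" using E(2) mr(1) by simp
  moreover have "3 * d u v * real (?E r) \<le> (w(cm u := w (cm u) + w (cm v) + d u v)) r"
    if "r \<in> reps n (merged n cm u v)" for r
  proof (cases "r = cm u")
    case True
    have "3 * d u v * real (?E r) = 3 * d u v * real (E (cm u)) + 3 * d u v * real (E (cm v))"
      by (simp add: True algebra_simps)
    then show ?thesis using E3[of "cm u"] E3[of "cm v"] ab nonneg[of u v] by (simp add: True)
  next
    case False
    then show ?thesis using E3[of r] that mr(1) by simp
  qed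
  ultimately show ?thesis unfolding certificate_def by blast
qed

text \<open>For merges forced by too many clusters: at least \<open>k\<close> clusters remain, so
  \<open>E = 0\<close> suffices.\<close>

lemma certificate_trivial:
  assumes "k \<le> card (reps n cm)"
  shows "certificate k n cm R w"
  unfolding certificate_def
  by (rule disjI2, rule exI[of _ "\<lambda>_. 0"]) (use assms w_nonneg in auto)

text \<open>With at most \<open>k\<close> clusters but more than \<open>k\<close> pieces, some tour
  is cut and hence longer than \<open>12 * R\<close>, while its cluster arose from fewer than
  \<open>n\<close> edges of length at most \<open>e\<close>. This limits the doublings since the
  last merge.\<close>

lemma long_tour:
  assumes "card (reps n cm) \<le> k" "k < length ps"
  shows "6 * R < real n * e"
proof -
  have "\<exists>r\<in>reps n cm. length (cuts r) \<noteq> 1"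
  proof (rule ccontr)
    assume "\<not> ?thesis"
    then have "length ps = card (reps n cm)" by (simp add: length_pieces)
    then show False using assms by simp
  qed
  then obtain r where r: "r \<in> reps n cm" "length (cuts r) \<noteq> 1" by blast
  have "\<not> path_length d (cy r) \<le> B"
    using cut_single[of d "[r]" "tl (cy r)" B] nonneg r(2) cuts_path[OF r(1)] by auto
  then have "6 * R < w r" using tour_le[OF r(1)] by simp
  also have "\<dots> \<le> (real (card (cluster n cm r)) - 1) * e" using clustering r by (simp add: clustering_def)
  also have "\<dots> \<le> real n * e"
  proof (rule mult_right_mono)
    have "card (cluster n cm r) \<le> card {..<n}" by (rule card_mono) (auto simp: cluster_def)
    then show "real (card (cluster n cm r)) - 1 \<le> real n" by simp
    show "0 \<le> e" using clustering by (simp add: clustering_def)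
  qed
  finally show ?thesis .
qed

end


section \<open>The approximation guarantee\<close>

text \<open>Eliminating \<open>E\<close> leaves an inequality affine in \<open>w\<close>: it suffices to check the value at
  \<open>w = 7 l\<close> and the slope, which are quadratics in \<open>l / R\<close> without real roots.\<close>

lemma excess_arith:
  fixes R l w E :: real
  assumes "0 \<le> l" "14 * l \<le> 12 * R" "0 < R" "0 \<le> E" "3 * R * E \<le> w" "7 * l \<le> w"
  shows "2 * w * (1 - 14 * l / (12 * R)) * (R + l) \<le> 14 * (R - l) * (w - (R + l) * E - l)"
proof -
  define t where "t = l / R"
  define y where "y = w - 7 * l"
  have l: "l = t * R" and w: "w = y + 7 * t * R" using assms(3) by (auto simp: t_def y_def)
  have t: "0 \<le> t" and y: "0 \<le> y" using assms by (auto simp: t_def y_def)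
  have lR: "l \<le> R" using assms by simp
  have "(R + l) * (3 * R * E) \<le> (R + l) * w" using assms by (intro mult_left_mono) auto
  then have E: "(R + l) * E \<le> (1 + t) * w / 3"
  proof -
    have "R * (3 * ((R + l) * E)) \<le> R * ((1 + t) * w)"
      using \<open>(R + l) * (3 * R * E) \<le> (R + l) * w\<close> by (simp add: l algebra_simps)
    then have "3 * ((R + l) * E) \<le> (1 + t) * w" using assms(3) by simp
    then show ?thesis by simp
  qed
  have "3 * (14 * (1 - t) * (w - (1 + t) * w / 3 - l)) - 3 * (2 * w * (1 - 7 * t / 6) * (1 + t))
      = y * (21 * t\<^sup>2 - 41 * t + 22) + 7 * t * R * (21 * t\<^sup>2 - 35 * t + 16)"
    unfolding w l by (simp add: field_simps power2_eq_square)
  moreover have "21 * t\<^sup>2 - 41 * t + 22 = 21 * (t - 41 / 42)\<^sup>2 + 167 / 84"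
    by (simp add: field_simps power2_eq_square)
  then have "0 \<le> 21 * t\<^sup>2 - 41 * t + 22" by simp
  moreover have "21 * t\<^sup>2 - 35 * t + 16 = 21 * (t - 5 / 6)\<^sup>2 + 17 / 12"
    by (simp add: field_simps power2_eq_square)
  then have "0 \<le> 21 * t\<^sup>2 - 35 * t + 16" by simp
  ultimately have "0 \<le> 3 * (14 * (1 - t) * (w - (1 + t) * w / 3 - l)) - 3 * (2 * w * (1 - 7 * t / 6) * (1 + t))"
    using t y assms(3) by simp
  then have "2 * w * (1 - 7 * t / 6) * (1 + t) \<le> 14 * (1 - t) * (w - (1 + t) * w / 3 - l)" by linarith
  then have "R * (2 * w * (1 - 7 * t / 6) * (1 + t)) \<le> R * (14 * (1 - t) * (w - (1 + t) * w / 3 - l))"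
    using assms(3) by (intro mult_left_mono) auto
  moreover have "R * (2 * w * (1 - 7 * t / 6) * (1 + t)) = 2 * w * (1 - 14 * l / (12 * R)) * (R + l)"
    unfolding l using assms(3) by (simp add: field_simps)
  moreover have "R * (14 * (1 - t) * (w - (1 + t) * w / 3 - l)) = 14 * (R - l) * (w - (1 + t) * w / 3 - l)"
    by (simp add: l algebra_simps)
  moreover have "14 * (R - l) * (w - (1 + t) * w / 3 - l) \<le> 14 * (R - l) * (w - (R + l) * E - l)"
    using E lR by (intro mult_left_mono) auto
  ultimately show ?thesis by linarith
qed

text \<open>Leads from covers to the counting interface of the lower bounds; weight can only drop
  when a spanning set of edges is selected.\<close>

lemma tree_cover_family:
  assumes metric: "Metric_space V d" and "finite V" and cov: "tree_cover V K T"
  obtains F where "cover_family V d K (\<lambda>i. verts (T i)) F"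
    "\<And>i. i < K \<Longrightarrow> sum (edge_length d) (F i) \<le> weight d (T i)"
proof -
  have tr: "tree_in V (T i)" if "i < K" for i using cov that by (simp add: tree_cover_def)
  have fin: "finite (verts (T i))" if "i < K" for i
    using tr[OF that] \<open>finite V\<close> by (auto simp: tree_in_def intro: finite_subset)
  have "\<exists>F \<subseteq> edges (T i). card F + 1 = card (verts (T i)) \<and>
      (\<forall>S. S \<inter> verts (T i) \<noteq> {} \<longrightarrow> card (inside F S) + 1 \<le> card (verts (T i) \<inter> S))" if "i < K" for i
    by (rule spanning_subtree) (use tr[OF that] fin[OF that] in \<open>auto simp: tree_in_def\<close>)
  then have "\<forall>i. \<exists>F. i < K \<longrightarrow> F \<subseteq> edges (T i) \<and> card F + 1 = card (verts (T i)) \<and>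
      (\<forall>S. S \<inter> verts (T i) \<noteq> {} \<longrightarrow> card (inside F S) + 1 \<le> card (verts (T i) \<inter> S))"
    by blast
  then obtain F where F: "\<And>i. i < K \<Longrightarrow> F i \<subseteq> edges (T i)"
    "\<And>i. i < K \<Longrightarrow> card (F i) + 1 = card (verts (T i))"
    "\<And>i S. i < K \<Longrightarrow> S \<inter> verts (T i) \<noteq> {} \<Longrightarrow> card (inside (F i) S) + 1 \<le> card (verts (T i) \<inter> S)"
    by metis
  have ed: "edges (T i) \<subseteq> {{u, v} | u v. u \<in> verts (T i) \<and> v \<in> verts (T i) \<and> u \<noteq> v}" if "i < K" for i
    using tr[OF that] by (simp add: tree_in_def)
  have "cover_family V d K (\<lambda>i. verts (T i)) F"
  proof (rule cover_family.intro)
    show "(\<Union>i<K. verts (T i)) = V" using cov by (simp add: tree_cover_def)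
    show "F i \<subseteq> {{u, v} | u v. u \<in> verts (T i) \<and> v \<in> verts (T i) \<and> u \<noteq> v}" if "i < K" for i
      using F(1)[OF that] ed[OF that] by (rule order_trans)
  qed (fact metric \<open>finite V\<close> F(2) F(3))+
  moreover have "sum (edge_length d) (F i) \<le> weight d (T i)" if i: "i < K" for i
    unfolding weight_def
  proof (rule sum_mono2)
    have "edges (T i) \<subseteq> Pow (verts (T i))" using ed[OF i] by auto
    then show "finite (edges (T i))" using fin[OF i] by (simp add: finite_subset)
    show "F i \<subseteq> edges (T i)" by (rule F(1)[OF i])
    fix f assume "f \<in> edges (T i) - F i"
    then obtain u v where "f = {u, v}" using ed[OF i] by auto
    then show "0 \<le> edge_length d f"
      by (simp add: edge_length_doubleton[OF metric] Metric_space.nonneg[OF metric])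
  qed
  ultimately show ?thesis using that by blast
qed

context cut_clustering
begin

text \<open>If \<open>14 * l\<close> is at least \<open>12 * R\<close>, no piece has any excess.
  Otherwise the pieces of a cluster outside \<open>L\<close> have total length at most
  \<open>14 * l\<close>, hence no excess, and \<open>E = 0\<close> holds there as the lower bound
  demands; inside \<open>L\<close>, excess and bound are compared cluster by cluster.\<close>

lemma excess_le:
  assumes cert: "certificate k n cm R w" and fam: "cover_family {..<n} d k U F"
    and l: "0 \<le> l"
  shows "sum_list (map (\<lambda>p. max 0 (path_length d p - 14 * l)) ps)
    \<le> 14 * (\<Sum>i<k. max 0 (sum (edge_length d) (F i) - l))"
proof (cases "14 * l < B")
  case False
  have "sum_list (map (\<lambda>p. max 0 (path_length d p - 14 * l)) ps) \<le> sum_list (map (\<lambda>p. 0) ps)"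
    by (rule sum_list_mono) (use False cuts_piece_le in \<open>fastforce simp: set_pieces\<close>)
  also have "\<dots> \<le> 14 * (\<Sum>i<k. max 0 (sum (edge_length d) (F i) - l))"
    by (simp add: sum_nonneg)
  finally show ?thesis .
next
  case True
  then have R: "0 < R" "l < R" using l by auto
  obtain E where E: "\<And>r. r \<in> reps n cm \<Longrightarrow> 3 * R * real (E r) \<le> w r" and k: "k \<le> (\<Sum>r\<in>reps n cm. E r + 1)"
    using cert R unfolding certificate_def by auto
  define L where "L = {r \<in> reps n cm. 0 < E r \<or> 7 * l < w r}"
  let ?f = "\<lambda>p. max 0 (path_length d p - 14 * l)"
  let ?X = "\<lambda>r. sum_list (map ?f (cuts r))"
  have cmr: "\<forall>v<n. cm v \<in> reps n cm" using clustering by (simp add: clustering_def)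
  have small: "?X r \<le> 0" if r: "r \<in> reps n cm" and w: "w r \<le> 7 * l" for r
  proof -
    have "path_length d p \<le> 14 * l" if p: "p \<in> set (cuts r)" for p
    proof -
      have "path_length d p \<le> sum_list (map (path_length d) (cuts r))"
        by (rule member_le_sum_list) (use p nonneg path_length_nonneg in auto)
      then show ?thesis using cuts_sum_le[OF r] w by simp
    qed
    then have "?X r \<le> sum_list (map (\<lambda>p. 0) (cuts r))" by (intro sum_list_mono) simp
    then show ?thesis by simp
  qed
  \<comment> \<open>On the interval from 0 to \<open>B\<close> the hinge lies below its chord, which
    is linear, so only the total length of the pieces matters.\<close>
  have big: "?X r \<le> 2 * w r * (1 - 14 * l / B)" if r: "r \<in> reps n cm" for r
  proof -
    have "?X r \<le> sum_list (map (\<lambda>p. path_length d p * (1 - 14 * l / B)) (cuts r))"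
    proof (rule sum_list_mono)
      fix p assume "p \<in> set (cuts r)"
      then have p: "path_length d p \<le> B" by (rule cuts_piece_le)
      have "0 \<le> path_length d p * (1 - 14 * l / B)"
        using True R nonneg by (intro mult_nonneg_nonneg path_length_nonneg) auto
      moreover have "path_length d p * (14 * l) \<le> B * (14 * l)" using p l by (intro mult_right_mono) auto
      then have "path_length d p - 14 * l \<le> path_length d p * (1 - 14 * l / B)"
        using R by (simp add: field_simps)
      ultimately show "?f p \<le> path_length d p * (1 - 14 * l / B)" by simp
    qed
    also have "\<dots> = sum_list (map (path_length d) (cuts r)) * (1 - 14 * l / B)"
      by (simp add: sum_list_mult_const)
    also have "\<dots> \<le> 2 * w r * (1 - 14 * l / B)"
      using cuts_sum_le[OF r] True R by (intro mult_right_mono) auto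
    finally show ?thesis .
  qed
  have L: "(R + l) * ?X r \<le> 14 * (R - l) * (w r - (R + l) * E r - l)" if r: "r \<in> L" for r
  proof (cases "7 * l < w r")
    case True
    have rr: "r \<in> reps n cm" using r by (simp add: L_def)
    have "(R + l) * ?X r \<le> (R + l) * (2 * w r * (1 - 14 * l / B))"
      using big[OF rr] R l by (intro mult_left_mono) auto
    also have "\<dots> \<le> 14 * (R - l) * (w r - (R + l) * E r - l)"
      using excess_arith[of l R "real (E r)" "w r"] \<open>14 * l < B\<close> R l E[OF rr] True
      by (simp add: mult.commute)
    finally show ?thesis .
  next
    case False
    then have rr: "r \<in> reps n cm" "0 < E r" using r by (auto simp: L_def)
    have "(R + l) * ?X r \<le> 0" using small[OF rr(1)] False R l by (intro mult_nonneg_nonpos) auto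
    \<comment> \<open>Here \<open>E r \<ge> 1\<close>, and \<open>3 * R * E r\<close> exceeds the
      charge \<open>(R + l) * E r + l\<close> because \<open>l < R\<close>.\<close>
    moreover have "0 \<le> 14 * (R - l) * (w r - (R + l) * E r - l)"
    proof -
      have "(2 * R - l) * 1 \<le> (2 * R - l) * E r" using rr(2) R by (intro mult_left_mono) auto
      then have "0 \<le> w r - (R + l) * E r - l" using E[OF rr(1)] R by (simp add: algebra_simps)
      then show ?thesis using R by simp
    qed
    ultimately show ?thesis by simp
  qed
  have "(R + l) * sum_list (map ?f ps) = (\<Sum>r\<in>reps n cm. (R + l) * ?X r)"
    by (simp only: sum_list_pieces sum_distrib_left)
  also have "\<dots> = (\<Sum>r\<in>L. (R + l) * ?X r) + (\<Sum>r\<in>reps n cm - L. (R + l) * ?X r)"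
    by (subst sum.subset_diff[of L]) (auto simp: L_def)
  also have "(\<Sum>r\<in>reps n cm - L. (R + l) * ?X r) \<le> 0"
    by (rule sum_nonpos) (use small R l in \<open>auto simp: L_def intro!: mult_nonneg_nonpos\<close>)
  also have "(\<Sum>r\<in>L. (R + l) * ?X r) \<le> (\<Sum>r\<in>L. 14 * (R - l) * (w r - (R + l) * E r - l))"
    by (rule sum_mono) (rule L)
  also have "\<dots> = 14 * ((R - l) * (\<Sum>r\<in>L. w r - (R + l) * E r - l))"
    by (simp only: sum_distrib_left mult.assoc)
  also have "(R - l) * (\<Sum>r\<in>L. w r - (R + l) * E r - l)
      \<le> (R + l) * (\<Sum>i<k. max 0 (sum (edge_length d) (F i) - l))"
  proof (rule cover_family.excess_lower_bound[OF fam, where P = "reps n cm" and C = "cluster n cm"])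
    show "R \<le> d u v" if "r \<in> reps n cm" "s \<in> reps n cm" "r \<noteq> s" "u \<in> cluster n cm r" "v \<in> cluster n cm s" for r s u v
      using that clustering by (auto simp: clustering_def cluster_def)
    show "cluster n cm r \<noteq> {}" if "r \<in> reps n cm" for r
      using rep_in_cluster[OF that] by blast
    show "cover_bound {..<n} d (cluster n cm r) (w r) R" if "r \<in> reps n cm" for r
      using that clustering by (simp add: clustering_def)
    show "E r = 0" if "r \<in> reps n cm - L" for r using that by (simp add: L_def)
  qed (use Union_cluster[OF cmr] cluster_disjoint k l R in \<open>auto simp: L_def\<close>)
  finally have "(R + l) * sum_list (map ?f ps) \<le> (R + l) * (14 * (\<Sum>i<k. max 0 (sum (edge_length d) (F i) - l)))"
    by (simp add: mult.left_commute)
  then show ?thesis using R l by (simp only: mult_le_cancel_left_pos add_pos_nonneg)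
qed

theorem pieces_approximate:
  assumes cert: "certificate k n cm R w" and cov: "tree_cover {..<n} k T" and p: "1 \<le> p"
  shows "(\<Sum>i<length ps. path_length d (ps ! i) powr p) powr (1 / p)
    \<le> 14 * (\<Sum>i<k. weight d (T i) powr p) powr (1 / p)"
proof -
  obtain F where fam: "cover_family {..<n} d k (\<lambda>i. verts (T i)) F"
    and F: "\<And>i. i < k \<Longrightarrow> sum (edge_length d) (F i) \<le> weight d (T i)"
    using tree_cover_family[OF metric finite_lessThan cov] by metis
  have F0: "0 \<le> sum (edge_length d) (F i)" if "i < k" for i
    by (rule sum_nonneg) (rule cover_family.edge_length_nonneg[OF fam that])
  show ?thesis
  proof (rule weak_majorization_powr[OF p])
    show "(\<Sum>i<length ps. max 0 (path_length d (ps ! i) - 14 * l)) \<le> 14 * (\<Sum>i<k. max 0 (weight d (T i) - l))"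
      if "0 \<le> l" for l
    proof -
      have "(\<Sum>i<length ps. max 0 (path_length d (ps ! i) - 14 * l))
          = sum_list (map (\<lambda>p. max 0 (path_length d p - 14 * l)) ps)"
        by (simp add: sum_list_sum_nth atLeast0LessThan)
      also have "\<dots> \<le> 14 * (\<Sum>i<k. max 0 (sum (edge_length d) (F i) - l))"
        by (rule excess_le[OF cert fam that])
      also have "\<dots> \<le> 14 * (\<Sum>i<k. max 0 (weight d (T i) - l))"
        by (intro mult_left_mono sum_mono max.mono diff_right_mono F) auto
      finally show ?thesis .
    qed
    show "0 \<le> weight d (T i)" if "i \<in> {..<k}" for i using F[of i] F0[of i] that by simp
  qed (use nonneg path_length_nonneg in auto)
qed

end


section \<open>Paths as trees\<close>

definition path_graph :: "'a list \<Rightarrow> 'a ugraph" where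
  "path_graph xs = \<lparr>verts = set xs, edges = {{xs ! i, xs ! Suc i} | i. Suc i < length xs}\<rparr>"

lemma path_graph_Nil: "path_graph [] = \<lparr>verts = {}, edges = {}\<rparr>"
  by (simp add: path_graph_def)

lemma path_graph_single: "path_graph [v] = \<lparr>verts = {v}, edges = {}\<rparr>"
  by (simp add: path_graph_def)

lemma path_graph_snoc:
  assumes "xs \<noteq> []"
  shows "path_graph (xs @ [v]) =
    \<lparr>verts = insert v (verts (path_graph xs)), edges = insert {last xs, v} (edges (path_graph xs))\<rparr>"
proof -
  have "{{(xs @ [v]) ! i, (xs @ [v]) ! Suc i} | i. Suc i < length (xs @ [v])}
      = insert {last xs, v} {{xs ! i, xs ! Suc i} | i. Suc i < length xs}" (is "?A = ?B")
  proof
    show "?A \<subseteq> ?B"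
    proof
      fix x assume "x \<in> ?A"
      then obtain i where i: "x = {(xs @ [v]) ! i, (xs @ [v]) ! Suc i}" "Suc i < Suc (length xs)" by auto
      show "x \<in> ?B"
      proof (cases "Suc i = length xs")
        case True
        then have "last xs = xs ! i" using assms by (metis diff_Suc_1 last_conv_nth)
        then show ?thesis using i True by (simp add: nth_append)
      next
        case False
        then show ?thesis using i by (auto simp: nth_append)
      qed
    qed
    show "?B \<subseteq> ?A"
    proof
      fix x assume "x \<in> ?B"
      then consider "x = {last xs, v}" | i where "x = {xs ! i, xs ! Suc i}" "Suc i < length xs" by auto
      then show "x \<in> ?A"
      proof cases
        case 1
        then show ?thesis using assms
          by (intro CollectI exI[of _ "length xs - 1"]) (auto simp: nth_append last_conv_nth)
      next
        case (2 i)
        then show ?thesis by (intro CollectI exI[of _ i]) (auto simp: nth_append)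
      qed
    qed
  qed
  then show ?thesis by (simp add: path_graph_def)
qed

lemma path_length_nth: "path_length d xs = (\<Sum>i<length xs - 1. d (xs ! i) (xs ! Suc i))"
proof (induction d xs rule: path_length.induct)
  case (1 d x y zs)
  then show ?case by (simp add: sum.lessThan_Suc_shift del: sum.lessThan_Suc)
qed auto

lemma weight_path_graph_nonneg:
  assumes "Metric_space V d"
  shows "0 \<le> weight d (path_graph xs)"
  unfolding weight_def
  by (rule sum_nonneg)
    (auto simp: path_graph_def edge_length_doubleton[OF assms] Metric_space.nonneg[OF assms])

text \<open>Edges form a set, so an edge repeated along the list counts once in the weight but each
  time in the path length.\<close>

lemma weight_path_graph_le:
  assumes "Metric_space V d"
  shows "weight d (path_graph xs) \<le> path_length d xs"
proof -
  have "edges (path_graph xs) = (\<lambda>i. {xs ! i, xs ! Suc i}) ` {..<length xs - 1}"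
    by (auto simp: path_graph_def)
  then have "weight d (path_graph xs) \<le> sum (edge_length d \<circ> (\<lambda>i. {xs ! i, xs ! Suc i})) {..<length xs - 1}"
    unfolding weight_def
    by (simp only:) (rule sum_image_le,
      auto simp: edge_length_doubleton[OF assms] Metric_space.nonneg[OF assms])
  then show ?thesis by (simp add: path_length_nth edge_length_doubleton[OF assms])
qed

text \<open>A vertex of a cycle in the path that comes last on the path would have only one neighbour on the cycle.\<close>

lemma path_graph_acyclic:
  assumes "distinct xs"
  shows "\<not> is_cycle (path_graph xs) ys"
proof
  assume "is_cycle (path_graph xs) ys"
  then have m: "3 \<le> length ys" and dist: "distinct ys"
    and ed: "\<And>i. i < length ys \<Longrightarrow> {ys ! i, ys ! (Suc i mod length ys)} \<in> edges (path_graph xs)"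
    by (auto simp: is_cycle_def)
  let ?m = "length ys"
  have "\<forall>v\<in>set xs. \<exists>j<length xs. xs ! j = v" by (simp add: in_set_conv_nth)
  then obtain pos where pos: "\<And>v. v \<in> set xs \<Longrightarrow> pos v < length xs \<and> xs ! pos v = v" by metis
  have pos_nth: "pos (xs ! j) = j" if "j < length xs" for j
    using pos[OF nth_mem[OF that]] that assms by (metis nth_eq_iff_index_eq)
  have adj: "(pos a = Suc (pos b) \<or> pos b = Suc (pos a)) \<and> a \<in> set xs \<and> b \<in> set xs"
    if ab: "{a, b} \<in> edges (path_graph xs)" for a b
  proof -
    obtain j where j: "{a, b} = {xs ! j, xs ! Suc j}" "Suc j < length xs"
      using ab unfolding path_graph_def ugraph.simps by blast
    then show ?thesis using pos_nth[of j] pos_nth[of "Suc j"] by (auto simp: doubleton_eq_iff)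
  qed
  let ?P = "(\<lambda>i. pos (ys ! i)) ` {..<?m}"
  have "0 < ?m" using m by linarith
  then have ne: "?P \<noteq> {}" by blast
  have "Max ?P \<in> ?P" by (rule Max_in) (use ne in auto)
  then obtain i where i: "i < ?m" "pos (ys ! i) = Max ?P" by auto
  have max: "pos (ys ! j) \<le> pos (ys ! i)" if "j < ?m" for j
    unfolding i(2) by (rule Max_ge) (use that in auto)
  define j where "j = Suc i mod ?m"
  define h where "h = (if i = 0 then ?m - 1 else i - 1)"
  have jeq: "j = (if Suc i = ?m then 0 else Suc i)"
    using i(1) by (cases "Suc i = ?m") (simp_all add: j_def)
  have jm: "j < ?m" and hm: "h < ?m" using m i(1) jeq by (auto simp: h_def split: if_splits)
  have hi: "Suc h mod ?m = i" using m i(1) by (cases "i = 0") (simp_all add: h_def)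
  have "{ys ! i, ys ! j} \<in> edges (path_graph xs)" using ed[OF i(1)] by (simp add: j_def)
  note 1 = adj[OF this]
  have "{ys ! h, ys ! i} \<in> edges (path_graph xs)" using ed[OF hm] hi by simp
  note 2 = adj[OF this]
  have "pos (ys ! j) = pos (ys ! h)" using 1 2 max[OF jm] max[OF hm] by linarith
  then have "ys ! j = ys ! h" using pos 1 2 by metis
  then have "j = h" using dist jm hm by (simp add: nth_eq_iff_index_eq)
  then show False using m i(1) jeq by (auto simp: h_def split: if_splits)
qed

lemma path_graph_tree:
  assumes "xs \<noteq> []" "distinct xs" "set xs \<subseteq> V"
  shows "tree_in V (path_graph xs)"
proof -
  let ?r = "{(x, y). {x, y} \<in> edges (path_graph xs)}"
  have "sym ?r" by (auto simp: sym_def insert_commute)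
  then have sym: "sym (?r\<^sup>*)" by (rule sym_rtrancl)
  have reach: "(xs ! 0, xs ! i) \<in> ?r\<^sup>*" if "i < length xs" for i
    using that
  proof (induction i)
    case (Suc i)
    have "(xs ! i, xs ! Suc i) \<in> ?r" using Suc.prems by (auto simp: path_graph_def)
    then show ?case using Suc by (meson Suc_lessD rtrancl.rtrancl_into_rtrancl)
  qed simp
  have "connected_graph (path_graph xs)"
    unfolding connected_graph_def
  proof (intro ballI)
    fix u v assume "u \<in> verts (path_graph xs)" "v \<in> verts (path_graph xs)"
    then obtain i j where "i < length xs" "u = xs ! i" "j < length xs" "v = xs ! j"
      by (auto simp: path_graph_def in_set_conv_nth)
    then show "(u, v) \<in> ?r\<^sup>*" using reach[of i] reach[of j] sym by (meson rtrancl_trans symD)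
  qed
  moreover have "edges (path_graph xs) \<subseteq> {{u, v} | u v. u \<in> set xs \<and> v \<in> set xs \<and> u \<noteq> v}"
  proof
    fix x assume "x \<in> edges (path_graph xs)"
    then obtain i where i: "x = {xs ! i, xs ! Suc i}" "Suc i < length xs" by (auto simp: path_graph_def)
    then have "xs ! i \<noteq> xs ! Suc i" using assms(2) by (simp add: nth_eq_iff_index_eq)
    then show "x \<in> {{u, v} | u v. u \<in> set xs \<and> v \<in> set xs \<and> u \<noteq> v}"
      using i nth_mem Suc_lessD by blast
  qed
  ultimately show ?thesis
    using assms path_graph_acyclic[OF assms(2)] by (simp add: tree_in_def path_graph_def)
qed

section \<open>Program logic\<close>

definition runs :: "com \<Rightarrow> state \<Rightarrow> nat \<Rightarrow> (state \<Rightarrow> bool) \<Rightarrow> bool" where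
  "runs c s m Q \<longleftrightarrow> (\<exists>t s'. exec c s t s' \<and> t \<le> m \<and> Q s')"

lemma runs_mono: "runs c s m Q \<Longrightarrow> m \<le> m' \<Longrightarrow> (\<And>s'. Q s' \<Longrightarrow> Q' s') \<Longrightarrow> runs c s m' Q'"
  unfolding runs_def by (meson order_trans)

lemma runs_Seq:
  assumes "runs c1 s m1 P" "\<And>s'. P s' \<Longrightarrow> runs c2 s' m2 Q"
  shows "runs (Seq c1 c2) s (m1 + m2) Q"
proof -
  obtain t1 s1 where 1: "exec c1 s t1 s1" "t1 \<le> m1" "P s1" using assms(1) by (auto simp: runs_def)
  obtain t2 s2 where 2: "exec c2 s1 t2 s2" "t2 \<le> m2" "Q s2" using assms(2)[OF 1(3)] by (auto simp: runs_def)
  show ?thesis unfolding runs_def using exec.Seq[OF 1(1) 2(1)] 1 2 by (meson add_mono)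
qed

lemma runs_If:
  assumes "bval b s \<Longrightarrow> runs c1 s m Q" "\<not> bval b s \<Longrightarrow> runs c2 s m Q"
  shows "runs (If b c1 c2) s (Suc m) Q"
proof (cases "bval b s")
  case True
  then show ?thesis using assms(1) exec.IfTrue unfolding runs_def by (meson Suc_le_mono)
next
  case False
  then show ?thesis using assms(2) exec.IfFalse unfolding runs_def by (meson Suc_le_mono)
qed

text \<open>The variant \<open>m\<close> bounds the number of iterations; each costs at most
  \<open>K\<close> steps and one test, and a last test ends the loop.\<close>

lemma runs_While:
  assumes "\<And>m s. I m s \<Longrightarrow> bval b s \<Longrightarrow> runs c s K (\<lambda>s'. \<exists>m'<m. I m' s')"
  shows "I m s \<Longrightarrow> runs (While b c) s (m * (K + 1) + 1) (\<lambda>s'. (\<exists>m'. I m' s') \<and> \<not> bval b s')"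
proof (induction m arbitrary: s rule: less_induct)
  case (less m)
  show ?case
  proof (cases "bval b s")
    case True
    obtain t1 s1 m' where 1: "exec c s t1 s1" "t1 \<le> K" "m' < m" "I m' s1"
      using assms[OF less.prems True] by (auto simp: runs_def)
    obtain t2 s2 where 2: "exec (While b c) s1 t2 s2" "t2 \<le> m' * (K + 1) + 1"
      "(\<exists>m'. I m' s2) \<and> \<not> bval b s2"
      using less.IH[OF 1(3,4)] by (auto simp: runs_def)
    have "Suc m' * (K + 1) \<le> m * (K + 1)" using 1(3) by (intro mult_le_mono1) simp
    then have "Suc (t1 + t2) \<le> m * (K + 1) + 1" using 1(2) 2(2) by simp
    then show ?thesis unfolding runs_def using exec.WhileTrue[OF True 1(1) 2(1)] 2(3) by blast
  next
    case False
    then show ?thesis unfolding runs_def using exec.WhileFalse[of b s c] less.prems by auto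
  qed
qed

section \<open>Symbolic evaluation of straight-line programs\<close>

primrec loop_free :: "com \<Rightarrow> bool" where
  "loop_free Skip \<longleftrightarrow> True"
| "loop_free (NStore a b e) \<longleftrightarrow> True"
| "loop_free (RStore a b e) \<longleftrightarrow> True"
| "loop_free (Seq c1 c2) \<longleftrightarrow> loop_free c1 \<and> loop_free c2"
| "loop_free (If b c1 c2) \<longleftrightarrow> loop_free c1 \<and> loop_free c2"
| "loop_free (While b c) \<longleftrightarrow> False"

text \<open>Evaluating loop-free code as a function lets simplification compute its effect. The
  clause for \<open>While\<close> is a placeholder that \<open>loop_free\<close> excludes.\<close>

primrec final :: "com \<Rightarrow> state \<Rightarrow> state" where
  "final Skip s = s"
| "final (NStore a b e) s = nupdate (nval a s) (nval b s) (nval e s) s"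
| "final (RStore a b e) s = rupdate (nval a s) (nval b s) (rval e s) s"
| "final (Seq c1 c2) s = final c2 (final c1 s)"
| "final (If b c1 c2) s = (if bval b s then final c1 s else final c2 s)"
| "final (While b c) s = s"

primrec steps :: "com \<Rightarrow> nat" where
  "steps Skip = 1"
| "steps (NStore a b e) = 1"
| "steps (RStore a b e) = 1"
| "steps (Seq c1 c2) = steps c1 + steps c2"
| "steps (If b c1 c2) = Suc (max (steps c1) (steps c2))"
| "steps (While b c) = 0"

lemma exec_loop_free: "loop_free c \<Longrightarrow> \<exists>t. exec c s t (final c s) \<and> t \<le> steps c"
proof (induction c arbitrary: s)
  case (Seq c1 c2)
  then obtain t1 t2 where "exec c1 s t1 (final c1 s)" "t1 \<le> steps c1"
    "exec c2 (final c1 s) t2 (final c2 (final c1 s))" "t2 \<le> steps c2"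
    by (metis loop_free.simps(4))
  then show ?case using exec.Seq by (auto intro!: exI[of _ "t1 + t2"])
next
  case (If b c1 c2)
  obtain t1 t2 where "exec c1 s t1 (final c1 s)" "t1 \<le> steps c1"
    "exec c2 s t2 (final c2 s)" "t2 \<le> steps c2"
    using If by (metis loop_free.simps(5))
  then show ?case
    using exec.IfTrue[of b s c1 t1] exec.IfFalse[of b s c2 t2] by (cases "bval b s") fastforce+
qed (auto intro: exec.intros)

lemma runs_loop_free:
  assumes "loop_free c" "steps c \<le> m" "Q (final c s)"
  shows "runs c s m Q"
  using exec_loop_free[OF assms(1), of s] assms(2,3) unfolding runs_def by (meson order_trans)

lemma nmem_nupdate [simp]: "nmem (nupdate i j x s) = (nmem s)(i := (nmem s i)(j := x))"
  and rmem_nupdate [simp]: "rmem (nupdate i j x s) = rmem s"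
  and nmem_rupdate [simp]: "nmem (rupdate i j y s) = nmem s"
  and rmem_rupdate [simp]: "rmem (rupdate i j y s) = (rmem s)(i := (rmem s i)(j := y))"
  by (simp_all add: nupdate_def rupdate_def)


section \<open>Loops, minimum edges and merges\<close>

abbreviation cell :: "nat \<Rightarrow> nexp" where
  "cell a \<equiv> NLoad (NConst 8) (NConst a)"

abbreviation assign :: "nat \<Rightarrow> nexp \<Rightarrow> com" where
  "assign a \<equiv> NStore (NConst 8) (NConst a)"

abbreviation neq :: "nexp \<Rightarrow> nexp \<Rightarrow> bexp" where
  "neq a b \<equiv> BNot (BAnd (BNot (NLess a b)) (BNot (NLess b a)))"

definition for_upto :: "nat \<Rightarrow> com \<Rightarrow> com" where
  "for_upto a c = Seq (assign a (NConst 0))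
     (While (NLess (cell a) (cell 0)) (Seq c (assign a (NAdd (cell a) (NConst 1)))))"

text \<open>The body preserves counter and bound. The invariant is demanded of the state after the
  increment, in which the next iteration starts; \<open>K + 2\<close> adds the test and the
  increment.\<close>

lemma runs_for_upto:
  assumes a: "a \<noteq> 0" and n: "nmem s 8 0 = n"
    and init: "I 0 (nupdate 8 a 0 s)"
    and step: "\<And>i s. i < n \<Longrightarrow> nmem s 8 a = i \<Longrightarrow> nmem s 8 0 = n \<Longrightarrow> I i s \<Longrightarrow>
      runs c s K (\<lambda>s'. nmem s' 8 a = i \<and> nmem s' 8 0 = n \<and> I (Suc i) (nupdate 8 a (Suc i) s'))"
  shows "runs (for_upto a c) s (n * (K + 2) + 2) (I n)"
proof -
  define J where "J = (\<lambda>m s. \<exists>i \<le> n. m = n - i \<and> nmem s 8 a = i \<and> nmem s 8 0 = n \<and> I i s)"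
  have loop: "runs (While (NLess (cell a) (cell 0)) (Seq c (assign a (NAdd (cell a) (NConst 1))))) s
      (m * (K + 1 + 1) + 1) (\<lambda>s'. (\<exists>m'. J m' s') \<and> \<not> bval (NLess (cell a) (cell 0)) s')"
    if "J m s" for m s
    using _ that
  proof (rule runs_While)
    fix m s assume "J m s" and b: "bval (NLess (cell a) (cell 0)) s"
    then obtain i where i: "i \<le> n" "m = n - i" "nmem s 8 a = i" "nmem s 8 0 = n" "I i s"
      by (auto simp: J_def)
    have "i < n" using b i by simp
    note st = step[OF this i(3,4,5)]
    show "runs (Seq c (assign a (NAdd (cell a) (NConst 1)))) s (K + 1) (\<lambda>s'. \<exists>m'<m. J m' s')"
    proof (rule runs_Seq[OF st])
      fix s' assume s': "nmem s' 8 a = i \<and> nmem s' 8 0 = n \<and> I (Suc i) (nupdate 8 a (Suc i) s')"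
      have "J (n - Suc i) (nupdate 8 a (Suc i) s')"
        unfolding J_def using s' \<open>i < n\<close> a by (intro exI[of _ "Suc i"]) auto
      then show "runs (assign a (NAdd (cell a) (NConst 1))) s' 1 (\<lambda>s'. \<exists>m'<m. J m' s')"
        by (intro runs_loop_free) (use s' \<open>i < n\<close> i(2) in \<open>auto intro!: exI[of _ "n - Suc i"]\<close>)
    qed
  qed
  have "J n (nupdate 8 a 0 s)" unfolding J_def using init n a by (intro exI[of _ 0]) auto
  then have "runs (for_upto a c) s (1 + (n * (K + 1 + 1) + 1))
      (\<lambda>s'. (\<exists>m'. J m' s') \<and> \<not> bval (NLess (cell a) (cell 0)) s')"
    unfolding for_upto_def
    by (intro runs_Seq[where P = "J n"] runs_loop_free loop) auto
  then show ?thesis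
    by (rule runs_mono) (auto simp: J_def)
qed

text \<open>Row 6 of the natural memory holds the successors on the tours, row 7 the cluster labels, row 8 the
  variables of the program (cell 2 is the number of clusters). The radius and the length of the current
  piece are stored in row \<open>n\<close> of the real memory, which the distance matrix leaves free.\<close>

definition store_ok ::
  "nat \<Rightarrow> nat \<Rightarrow> (nat \<Rightarrow> nat \<Rightarrow> real) \<Rightarrow> (nat \<Rightarrow> nat) \<Rightarrow> (nat \<Rightarrow> nat) \<Rightarrow> nat \<Rightarrow> real \<Rightarrow> state \<Rightarrow> bool"
where
  "store_ok n k d nx cm nc R s \<longleftrightarrow>
     nmem s 8 0 = n \<and> nmem s 8 1 = k \<and> nmem s 8 2 = nc \<and> nmem s 6 = nx \<and> nmem s 7 = cm \<and>
     rmem s n 0 = R \<and> (\<forall>u<n. \<forall>v<n. rmem s u v = d u v)"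

lemma store_ok_nupdate [simp]:
  "i \<noteq> 6 \<Longrightarrow> i \<noteq> 7 \<Longrightarrow> i \<noteq> 8 \<or> 2 < j \<Longrightarrow>
    store_ok n k d nx cm nc R (nupdate i j x s) = store_ok n k d nx cm nc R s"
  by (auto simp: store_ok_def)

lemma store_ok_rupdate [simp]:
  "store_ok n k d nx cm nc R (rupdate n (Suc 0) x s) = store_ok n k d nx cm nc R s"
  by (auto simp: store_ok_def)

definition init_prog :: com where
  "init_prog = Seq (assign 0 (NLoad (NConst 0) (NConst 0))) (Seq (assign 1 (NLoad (NConst 0) (NConst 1)))
     (Seq (assign 2 (cell 0))
       (for_upto 3 (Seq (NStore (NConst 6) (cell 3) (cell 3)) (NStore (NConst 7) (cell 3) (cell 3))))))"

lemma runs_init_prog: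
  "runs init_prog (input_state n d k) (4 * n + 5)
    (store_ok n k d (\<lambda>i. if i < n then i else 0) (\<lambda>i. if i < n then i else 0) n 0)"
proof -
  let ?f = "\<lambda>i j. if j < i then j else 0 :: nat"
  let ?I = "\<lambda>i s. store_ok n k d (?f i) (?f i) n 0 s"
  define c where "c = Seq (NStore (NConst 6) (cell 3) (cell 3)) (NStore (NConst 7) (cell 3) (cell 3))"
  define s0 where "s0 = nupdate 8 2 n (nupdate 8 1 k (nupdate 8 0 n (input_state n d k)))"
  have loop: "runs (for_upto 3 c) s0 (n * (2 + 2) + 2) (?I n)"
  proof (rule runs_for_upto[where I = ?I])
    show "nmem s0 8 0 = n" by (simp add: s0_def)
    show "?I 0 (nupdate 8 3 0 s0)"
      by (simp add: s0_def store_ok_def) (auto simp: input_state_def)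
    fix i s assume i: "i < n" "nmem s 8 3 = i" "nmem s 8 0 = n" "?I i s"
    have "?f (Suc i) = (?f i)(i := i)" by auto
    then show "runs c s 2 (\<lambda>s'. nmem s' 8 3 = i \<and> nmem s' 8 0 = n \<and> ?I (Suc i) (nupdate 8 3 (Suc i) s'))"
      using i by (intro runs_loop_free) (auto simp: c_def store_ok_def)
  qed simp
  have "runs init_prog (input_state n d k) (1 + (1 + (1 + (n * (2 + 2) + 2)))) (?I n)"
    unfolding init_prog_def c_def[symmetric]
    by (rule runs_Seq[where P = "\<lambda>s. s = nupdate 8 0 n (input_state n d k)"],
        rule runs_loop_free, simp, simp, simp add: input_state_def,
        rule runs_Seq[where P = "\<lambda>s. s = nupdate 8 1 k (nupdate 8 0 n (input_state n d k))"],
        rule runs_loop_free, simp, simp, simp add: input_state_def,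
        rule runs_Seq[where P = "\<lambda>s. s = s0"],
        rule runs_loop_free, simp, simp, simp add: s0_def)
      (use loop in simp)
  then show ?thesis by (rule runs_mono) auto
qed

text \<open>Cells 5 and 6 of row 8 hold the best pair so far; cell 7 is 0 if none has been seen.\<close>

definition find_prog :: com where
  "find_prog = Seq (assign 7 (NConst 0)) (for_upto 3 (for_upto 4
     (If (BAnd (neq (NLoad (NConst 7) (cell 3)) (NLoad (NConst 7) (cell 4)))
            (BNot (BAnd (NLess (NConst 0) (cell 7))
              (BNot (RLess (RLoad (cell 3) (cell 4)) (RLoad (cell 5) (cell 6)))))))
        (Seq (assign 5 (cell 3)) (Seq (assign 6 (cell 4)) (assign 7 (NConst 1))))
        Skip)))"

text \<open>\<open>D\<close> collects the pairs scanned so far, so one predicate serves as invariant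
  of both loops and as their result.\<close>

definition closest_pair ::
  "nat \<Rightarrow> (nat \<Rightarrow> nat \<Rightarrow> real) \<Rightarrow> (nat \<Rightarrow> nat) \<Rightarrow> (nat \<times> nat) set \<Rightarrow> state \<Rightarrow> bool"
where
  "closest_pair n d cm D s \<longleftrightarrow>
     (if nmem s 8 7 = 0 then \<forall>(u, v)\<in>D. cm u = cm v
      else nmem s 8 5 < n \<and> nmem s 8 6 < n \<and> cm (nmem s 8 5) \<noteq> cm (nmem s 8 6) \<and>
        (\<forall>(u, v)\<in>D. cm u \<noteq> cm v \<longrightarrow> d (nmem s 8 5) (nmem s 8 6) \<le> d u v))"

lemma runs_find_prog:
  assumes "store_ok n k d nx cm nc R s"
  shows "runs find_prog s (n * (n * 6 + 4) + 3)
    (\<lambda>s'. store_ok n k d nx cm nc R s' \<and> closest_pair n d cm ({..<n} \<times> {..<n}) s')"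
proof -
  let ?I = "\<lambda>D s. store_ok n k d nx cm nc R s \<and> closest_pair n d cm D s"
  define c where "c = If (BAnd (neq (NLoad (NConst 7) (cell 3)) (NLoad (NConst 7) (cell 4)))
            (BNot (BAnd (NLess (NConst 0) (cell 7))
              (BNot (RLess (RLoad (cell 3) (cell 4)) (RLoad (cell 5) (cell 6)))))))
        (Seq (assign 5 (cell 3)) (Seq (assign 6 (cell 4)) (assign 7 (NConst 1))))
        Skip"
  have body: "?I (insert (i, j) D) (final c s) \<and> nmem (final c s) 8 3 = i \<and> nmem (final c s) 8 4 = j"
    if "?I D s" "nmem s 8 3 = i" "nmem s 8 4 = j" "i < n" "j < n" for i j D s
  proof (cases "bval (BAnd (neq (NLoad (NConst 7) (cell 3)) (NLoad (NConst 7) (cell 4)))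
            (BNot (BAnd (NLess (NConst 0) (cell 7))
              (BNot (RLess (RLoad (cell 3) (cell 4)) (RLoad (cell 5) (cell 6))))))) s")
    case True
    then have "final c s = nupdate 8 7 1 (nupdate 8 6 j (nupdate 8 5 i s))"
      using that by (simp add: c_def)
    moreover have "cm i \<noteq> cm j" "nmem s 8 7 = 0 \<or> d i j < d (nmem s 8 5) (nmem s 8 6)"
      using True that by (auto simp: store_ok_def closest_pair_def split: if_splits)
    ultimately show ?thesis using that
      by (fastforce simp: closest_pair_def split: if_splits)
  next
    case False
    then have "final c s = s" by (simp only: c_def final.simps if_False)
    moreover have "cm i = cm j \<or> nmem s 8 7 \<noteq> 0 \<and> d (nmem s 8 5) (nmem s 8 6) \<le> d i j"
      using False that by (auto simp: store_ok_def closest_pair_def split: if_splits)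
    ultimately show ?thesis using that
      by (auto simp: closest_pair_def split: if_splits)
  qed
  have inner: "runs (for_upto 4 c) s (n * (4 + 2) + 2)
      (\<lambda>s'. nmem s' 8 3 = i \<and> ?I (({..<i} \<times> {..<n}) \<union> ({i} \<times> {..<n})) s')"
    if s: "?I ({..<i} \<times> {..<n}) s" "nmem s 8 3 = i" "i < n" for i s
  proof (rule runs_for_upto[where
        I = "\<lambda>j s. nmem s 8 3 = i \<and> ?I (({..<i} \<times> {..<n}) \<union> ({i} \<times> {..<j})) s"])
    show "nmem s 8 0 = n" using s(1) by (auto simp: store_ok_def)
    show "nmem (nupdate 8 4 0 s) 8 3 = i \<and> ?I (({..<i} \<times> {..<n}) \<union> ({i} \<times> {..<0})) (nupdate 8 4 0 s)"
      using s by (auto simp: closest_pair_def)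
    fix j s assume j: "j < n" "nmem s 8 4 = j" "nmem s 8 0 = n"
      "nmem s 8 3 = i \<and> ?I (({..<i} \<times> {..<n}) \<union> ({i} \<times> {..<j})) s"
    have eq: "({..<i} \<times> {..<n}) \<union> ({i} \<times> {..<Suc j}) = insert (i, j) (({..<i} \<times> {..<n}) \<union> ({i} \<times> {..<j}))"
      by auto
    have "?I (insert (i, j) (({..<i} \<times> {..<n}) \<union> ({i} \<times> {..<j}))) (final c s)
        \<and> nmem (final c s) 8 3 = i \<and> nmem (final c s) 8 4 = j"
      by (rule body) (use j s(3) in auto)
    then show "runs c s 4 (\<lambda>s'. nmem s' 8 4 = j \<and> nmem s' 8 0 = n \<and>
        nmem (nupdate 8 4 (Suc j) s') 8 3 = i \<and>
        ?I (({..<i} \<times> {..<n}) \<union> ({i} \<times> {..<Suc j})) (nupdate 8 4 (Suc j) s'))"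
      unfolding eq by (intro runs_loop_free) (auto simp: c_def[symmetric] closest_pair_def store_ok_def, simp_all add: c_def)
  qed simp
  have outer: "runs (for_upto 3 (for_upto 4 c)) s (n * (n * 6 + 2 + 2) + 2) (?I ({..<n} \<times> {..<n}))"
    if s: "store_ok n k d nx cm nc R s" "nmem s 8 7 = 0" for s
  proof (rule runs_for_upto[where I = "\<lambda>i. ?I ({..<i} \<times> {..<n})"])
    show "nmem s 8 0 = n" using s(1) by (auto simp: store_ok_def)
    show "?I ({..<0} \<times> {..<n}) (nupdate 8 3 0 s)" using s by (simp add: closest_pair_def)
    fix i s assume i: "i < n" "nmem s 8 3 = i" "nmem s 8 0 = n" "?I ({..<i} \<times> {..<n}) s"
    have eq: "{..<Suc i} \<times> {..<n} = ({..<i} \<times> {..<n}) \<union> ({i} \<times> {..<n})" by auto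
    show "runs (for_upto 4 c) s (n * 6 + 2) (\<lambda>s'. nmem s' 8 3 = i \<and> nmem s' 8 0 = n \<and>
        ?I ({..<Suc i} \<times> {..<n}) (nupdate 8 3 (Suc i) s'))"
      unfolding eq
      by (rule runs_mono[OF inner[OF i(4,2,1)]]) (auto simp: closest_pair_def store_ok_def)
  qed simp
  have "runs find_prog s (1 + (n * (n * 6 + 2 + 2) + 2)) (?I ({..<n} \<times> {..<n}))"
    unfolding find_prog_def c_def[symmetric]
    by (rule runs_Seq[where P = "\<lambda>s. store_ok n k d nx cm nc R s \<and> nmem s 8 7 = 0"],
        rule runs_loop_free, simp, simp) (use assms outer in auto)
  then show ?thesis by (rule runs_mono) (auto simp: algebra_simps)
qed

text \<open>Cells 10 and 11 keep the old labels of \<open>v\<close> and \<open>u\<close>, because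
  relabelling overwrites row 7; cell 9 is the buffer for the exchange of successors.\<close>

definition merge_prog :: com where
  "merge_prog = Seq (Seq (RStore (cell 0) (NConst 0) (RLoad (cell 5) (cell 6)))
      (Seq (assign 10 (NLoad (NConst 7) (cell 6))) (assign 11 (NLoad (NConst 7) (cell 5)))))
    (Seq (for_upto 3 (If (neq (NLoad (NConst 7) (cell 3)) (cell 10)) Skip
        (NStore (NConst 7) (cell 3) (cell 11))))
      (Seq (assign 9 (NLoad (NConst 6) (cell 5)))
        (Seq (NStore (NConst 6) (cell 5) (NLoad (NConst 6) (cell 6)))
          (Seq (NStore (NConst 6) (cell 6) (cell 9)) (assign 2 (NSub (cell 2) (NConst 1)))))))"

lemma runs_merge_prog:
  assumes s: "store_ok n k d nx cm nc R s" "nmem s 8 5 = u" "nmem s 8 6 = v" and uv: "u < n" "v < n"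
  shows "runs merge_prog s (4 * n + 9)
    (store_ok n k d (nx(u := nx v, v := nx u)) (merged n cm u v) (nc - 1) (d u v))"
proof -
  let ?f = "\<lambda>i x. if x < i \<and> cm x = cm v then cm u else cm x"
  let ?I = "\<lambda>i s. store_ok n k d nx (?f i) nc (d u v) s \<and> nmem s 8 5 = u \<and> nmem s 8 6 = v \<and>
    nmem s 8 10 = cm v \<and> nmem s 8 11 = cm u"
  define c where "c = If (neq (NLoad (NConst 7) (cell 3)) (cell 10)) Skip (NStore (NConst 7) (cell 3) (cell 11))"
  have f0: "?f 0 = cm" by simp
  have loop: "runs (for_upto 3 c) s (n * (2 + 2) + 2) (?I n)" if I0: "?I 0 s" for s
  proof (rule runs_for_upto[where I = ?I])
    show "nmem s 8 0 = n" using I0 by (simp add: store_ok_def)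
    show "?I 0 (nupdate 8 3 0 s)" using I0 by simp
    fix i s assume i: "i < n" "nmem s 8 3 = i" "nmem s 8 0 = n" "?I i s"
    have eq: "?f (Suc i) = (if cm i = cm v then (?f i)(i := cm u) else ?f i)" by (auto simp: less_Suc_eq)
    have cmi: "nmem s 7 i = cm i" using i by (simp add: store_ok_def)
    show "runs c s 2 (\<lambda>s'. nmem s' 8 3 = i \<and> nmem s' 8 0 = n \<and> ?I (Suc i) (nupdate 8 3 (Suc i) s'))"
    proof (rule runs_loop_free)
      show "nmem (final c s) 8 3 = i \<and> nmem (final c s) 8 0 = n \<and> ?I (Suc i) (nupdate 8 3 (Suc i) (final c s))"
        using i cmi unfolding eq by (auto simp: c_def store_ok_def)
    qed (simp_all add: c_def)
  qed simp
  have post: "runs (Seq (assign 9 (NLoad (NConst 6) (cell 5)))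
        (Seq (NStore (NConst 6) (cell 5) (NLoad (NConst 6) (cell 6)))
          (Seq (NStore (NConst 6) (cell 6) (cell 9)) (assign 2 (NSub (cell 2) (NConst 1)))))) s 4
      (store_ok n k d (nx(u := nx v, v := nx u)) (merged n cm u v) (nc - 1) (d u v))" if "?I n s" for s
    by (rule runs_loop_free) (use that in \<open>auto simp: store_ok_def merged_def\<close>)
  have "runs merge_prog s (3 + (n * (2 + 2) + 2 + 4))
      (store_ok n k d (nx(u := nx v, v := nx u)) (merged n cm u v) (nc - 1) (d u v))"
    unfolding merge_prog_def c_def[symmetric]
  proof (rule runs_Seq[where P = "?I 0"])
    show "runs (Seq (RStore (cell 0) (NConst 0) (RLoad (cell 5) (cell 6)))
      (Seq (assign 10 (NLoad (NConst 7) (cell 6))) (assign 11 (NLoad (NConst 7) (cell 5))))) s 3 (?I 0)"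
      unfolding f0 by (rule runs_loop_free) (use s uv in \<open>auto simp: store_ok_def\<close>)
  next
    fix s' assume "?I 0 s'"
    then show "runs (Seq (for_upto 3 c) (Seq (assign 9 (NLoad (NConst 6) (cell 5)))
        (Seq (NStore (NConst 6) (cell 5) (NLoad (NConst 6) (cell 6)))
          (Seq (NStore (NConst 6) (cell 6) (cell 9)) (assign 2 (NSub (cell 2) (NConst 1)))))))
      s' (n * (2 + 2) + 2 + 4) (store_ok n k d (nx(u := nx v, v := nx u)) (merged n cm u v) (nc - 1) (d u v))"
      by (rule runs_Seq[OF loop post])
  qed
  then show ?thesis by (rule runs_mono) auto
qed

definition double_prog :: com where
  "double_prog = RStore (cell 0) (NConst 0)
    (RAdd (RLoad (cell 0) (NConst 0)) (RLoad (cell 0) (NConst 0)))"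

lemma runs_double_prog:
  assumes "store_ok n k d nx cm nc R s"
  shows "runs double_prog s 1 (store_ok n k d nx cm nc (R + R))"
  by (rule runs_loop_free) (use assms in \<open>auto simp: double_prog_def store_ok_def\<close>)


section \<open>Writing the paths\<close>

text \<open>Effect of appending one record. The range of \<open>f\<close> is arbitrary, so vertex
  and edge records are treated alike.\<close>

lemma records_Suc:
  assumes "f' m = x" "g' m = t" "\<And>i. i < m \<Longrightarrow> f' i = f i \<and> g' i = g i"
  shows "{f' i | i. i < Suc m \<and> g' i = j} =
    (if t = j then insert x {f i | i. i < m \<and> g i = j} else {f i | i. i < m \<and> g i = (j :: nat)})"
proof -
  have "{i. i < Suc m \<and> g' i = j} = (if t = j then insert m {i. i < m \<and> g i = j} else {i. i < m \<and> g i = j})"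
    using assms(2,3) by (auto simp: less_Suc_eq)
  moreover have "f' ` {i. i < m \<and> g i = j} = f ` {i. i < m \<and> g i = j}"
    by (rule image_cong) (use assms(3) in auto)
  ultimately show ?thesis using assms(1) by (simp add: setcompr_eq_image)
qed

text \<open>Indices from \<open>length ps\<close> on must not occur in any record, since the next tree gets index \<open>length ps\<close>.\<close>

definition output_paths :: "state \<Rightarrow> nat list list \<Rightarrow> bool" where
  "output_paths s ps \<longleftrightarrow> nmem s 0 0 = length ps \<and>
     (\<forall>j. output_tree s j = path_graph (if j < length ps then ps ! j else []))"

lemma output_paths_new:
  assumes "output_paths s ps" "nmem s' 0 0 = Suc (nmem s 0 0)" "nmem s' 0 1 = Suc (nmem s 0 1)"
    "nmem s' 0 2 = nmem s 0 2"
    "nmem s' 1 = (nmem s 1)(nmem s 0 1 := nmem s 0 0)" "nmem s' 2 = (nmem s 2)(nmem s 0 1 := v)"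
    "nmem s' 3 = nmem s 3" "nmem s' 4 = nmem s 4" "nmem s' 5 = nmem s 5"
  shows "output_paths s' (ps @ [[v]])"
proof -
  have len: "nmem s 0 0 = length ps" using assms(1) by (simp add: output_paths_def)
  have "output_tree s' j = path_graph (if j < length (ps @ [[v]]) then (ps @ [[v]]) ! j else [])" for j
  proof -
    have old: "output_tree s j = path_graph (if j < length ps then ps ! j else [])"
      using assms(1) by (simp add: output_paths_def)
    have v: "verts (output_tree s' j)
        = (if length ps = j then insert v (verts (output_tree s j)) else verts (output_tree s j))"
      unfolding output_tree_def ugraph.simps assms(3)
      by (rule records_Suc) (use assms len in auto)
    have e: "edges (output_tree s' j) = edges (output_tree s j)"
      using assms by (simp add: output_tree_def)
    show ?thesis
    proof (cases "j = length ps")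
      case True
      then show ?thesis using v e old by (simp add: path_graph_Nil path_graph_single)
    next
      case False
      then have "output_tree s' j = output_tree s j" using v e by simp
      then show ?thesis using old False by (auto simp: nth_append)
    qed
  qed
  then show ?thesis using assms(2) len by (simp add: output_paths_def)
qed

lemma output_paths_extend:
  assumes "output_paths s (ps @ [cur])" "cur \<noteq> []" "nmem s' 0 0 = nmem s 0 0"
    "nmem s' 0 1 = Suc (nmem s 0 1)" "nmem s' 0 2 = Suc (nmem s 0 2)"
    "nmem s' 1 = (nmem s 1)(nmem s 0 1 := nmem s 0 0 - 1)" "nmem s' 2 = (nmem s 2)(nmem s 0 1 := v)"
    "nmem s' 3 = (nmem s 3)(nmem s 0 2 := nmem s 0 0 - 1)"
    "nmem s' 4 = (nmem s 4)(nmem s 0 2 := last cur)" "nmem s' 5 = (nmem s 5)(nmem s 0 2 := v)"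
  shows "output_paths s' (ps @ [cur @ [v]])"
proof -
  have len: "nmem s 0 0 = Suc (length ps)" using assms(1) by (simp add: output_paths_def)
  have "output_tree s' j = path_graph (if j < length (ps @ [cur @ [v]]) then (ps @ [cur @ [v]]) ! j else [])" for j
  proof -
    have old: "output_tree s j = path_graph (if j < length (ps @ [cur]) then (ps @ [cur]) ! j else [])"
      using assms(1) by (simp add: output_paths_def)
    have v: "verts (output_tree s' j)
        = (if length ps = j then insert v (verts (output_tree s j)) else verts (output_tree s j))"
      unfolding output_tree_def ugraph.simps assms(4)
      by (rule records_Suc) (use assms len in auto)
    have e: "edges (output_tree s' j)
        = (if length ps = j then insert {last cur, v} (edges (output_tree s j)) else edges (output_tree s j))"
      unfolding output_tree_def ugraph.simps assms(5)
      by (rule records_Suc) (use assms len in auto)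
    show ?thesis
    proof (cases "j = length ps")
      case True
      then show ?thesis using v e old by (simp add: path_graph_snoc[OF assms(2)])
    next
      case False
      then have "output_tree s' j = output_tree s j" using v e by simp
      then show ?thesis using old False by (auto simp: nth_append)
    qed
  qed
  then show ?thesis using assms(3) len by (simp add: output_paths_def)
qed

lemma output_paths_cong:
  assumes "\<And>i. i \<le> 5 \<Longrightarrow> nmem s' i = nmem s i"
  shows "output_paths s' ps = output_paths s ps"
proof -
  have "output_tree s' = output_tree s" unfolding output_tree_def using assms by simp
  then show ?thesis using assms[of 0] by (simp add: output_paths_def)
qed

lemma output_paths_nupdate [simp]: "5 < i \<Longrightarrow> output_paths (nupdate i j x s) ps = output_paths s ps"
  by (rule output_paths_cong) auto

lemma output_paths_rupdate [simp]: "output_paths (rupdate i j y s) ps = output_paths s ps"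
  by (rule output_paths_cong) auto

abbreviation row :: "nat \<Rightarrow> nexp \<Rightarrow> nexp \<Rightarrow> com" where
  "row i \<equiv> NStore (NConst i)"

abbreviation count :: "nat \<Rightarrow> nexp" where
  "count j \<equiv> NLoad (NConst 0) (NConst j)"

abbreviation radius :: rexp where
  "radius \<equiv> RLoad (cell 0) (NConst 0)"

abbreviation so_far :: rexp where
  "so_far \<equiv> RLoad (cell 0) (NConst 1)"

text \<open>Expressions contain no real constants, so the length of the fresh piece is reset to 0 as
  \<open>radius\<close> minus itself.\<close>

definition new_piece_prog :: "nexp \<Rightarrow> com" where
  "new_piece_prog v = Seq (row 1 (count 1) (count 0)) (Seq (row 2 (count 1) v)
     (Seq (row 0 (NConst 1) (NAdd (count 1) (NConst 1))) (Seq (row 0 (NConst 0) (NAdd (count 0) (NConst 1)))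
       (RStore (cell 0) (NConst 1) (RSub radius radius)))))"

definition extend_prog :: com where
  "extend_prog = Seq (row 1 (count 1) (NSub (count 0) (NConst 1))) (Seq (row 2 (count 1) (cell 9))
     (Seq (row 0 (NConst 1) (NAdd (count 1) (NConst 1)))
       (Seq (row 3 (count 2) (NSub (count 0) (NConst 1))) (Seq (row 4 (count 2) (cell 8))
         (Seq (row 5 (count 2) (cell 9)) (Seq (row 0 (NConst 2) (NAdd (count 2) (NConst 1)))
           (RStore (cell 0) (NConst 1) (RAdd so_far (RLoad (cell 8) (cell 9))))))))))"

abbreviation twice :: "rexp \<Rightarrow> rexp" where
  "twice a \<equiv> RAdd a a"

text \<open>The bound \<open>12 * R\<close> is formed by additions alone, as
  \<open>8 * R + 4 * R\<close>.\<close>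

definition advance_prog :: com where
  "advance_prog = Seq (If (RLess (RAdd (twice (twice (twice radius))) (twice (twice radius)))
          (RAdd so_far (RLoad (cell 8) (cell 9))))
        (new_piece_prog (cell 9)) extend_prog)
     (Seq (assign 8 (cell 9)) (assign 9 (NLoad (NConst 6) (cell 9))))"

definition cut_tour_prog :: com where
  "cut_tour_prog = If (neq (NLoad (NConst 7) (cell 3)) (cell 3)) Skip
     (Seq (Seq (new_piece_prog (cell 3)) (Seq (assign 8 (cell 3)) (assign 9 (NLoad (NConst 6) (cell 3)))))
       (While (neq (cell 9) (cell 3)) advance_prog))"

definition cut_prog :: com where
  "cut_prog = Seq (Seq (row 0 (NConst 0) (NConst 0)) (Seq (row 0 (NConst 1) (NConst 0)) (row 0 (NConst 2) (NConst 0))))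
     (for_upto 3 cut_tour_prog)"

lemma final_new_piece:
  assumes "store_ok n k d nx cm nc R s" "output_paths s ps" and x: "nmem s 8 x = v"
  defines "s' \<equiv> final (new_piece_prog (cell x)) s"
  shows "store_ok n k d nx cm nc R s'" "output_paths s' (ps @ [[v]])" "rmem s' n 1 = 0"
    "nmem s' 8 = nmem s 8"
proof -
  have n: "nmem s 8 0 = n" using assms(1) by (simp add: store_ok_def)
  show "store_ok n k d nx cm nc R s'" "rmem s' n 1 = 0" "nmem s' 8 = nmem s 8"
    using assms(1) n unfolding s'_def new_piece_prog_def by (auto simp: store_ok_def)
  show "output_paths s' (ps @ [[v]])"
    by (rule output_paths_new[OF assms(2)]) (use x in \<open>auto simp: s'_def new_piece_prog_def\<close>)
qed

lemma final_extend:
  assumes "store_ok n k d nx cm nc R s" "output_paths s (ps @ [cur])" "cur \<noteq> []"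
    and u: "nmem s 8 8 = last cur" and v: "nmem s 8 9 = v"
  defines "s' \<equiv> final extend_prog s"
  shows "store_ok n k d nx cm nc R s'" "output_paths s' (ps @ [cur @ [v]])"
    "rmem s' n 1 = rmem s n 1 + rmem s (last cur) v" "nmem s' 8 = nmem s 8"
proof -
  have n: "nmem s 8 0 = n" using assms(1) by (simp add: store_ok_def)
  show "store_ok n k d nx cm nc R s'" "rmem s' n 1 = rmem s n 1 + rmem s (last cur) v" "nmem s' 8 = nmem s 8"
    using assms(1) n u v unfolding s'_def extend_prog_def by (auto simp: store_ok_def)
  show "output_paths s' (ps @ [cur @ [v]])"
    by (rule output_paths_extend[OF assms(2,3)]) (use u v in \<open>auto simp: s'_def extend_prog_def\<close>)
qed

lemma tour_next:
  assumes "tour nx (us @ v # vs)" "hd (us @ v # vs) = r"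
  shows "nx v = (if vs = [] then r else hd vs)"
proof -
  have "nx ((us @ v # vs) ! length us) = (us @ v # vs) ! (Suc (length us) mod length (us @ v # vs))"
    by (rule tour_nth[OF assms(1)]) simp
  moreover have "(us @ v # vs) ! (Suc (length us) mod length (us @ v # vs)) = (if vs = [] then r else hd vs)"
  proof (cases vs)
    case Nil
    then show ?thesis using assms(2) by (cases us) auto
  next
    case (Cons y ys)
    then show ?thesis by (simp add: nth_append)
  qed
  ultimately show ?thesis by simp
qed

section \<open>Correctness of the cutting loops\<close>

context cut_clustering
begin

text \<open>\<open>goal\<close> is the fixed output to be reached: the paths already closed,
  followed by the cut that is still to be computed from the open piece \<open>cur\<close>.
  \<open>us\<close> is the part of the tour already walked, and the number of points left is the
  variant.\<close>

definition cutting :: "nat \<Rightarrow> nat \<Rightarrow> nat \<Rightarrow> nat list list \<Rightarrow> nat \<Rightarrow> state \<Rightarrow> bool" where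
  "cutting k nc r goal m s \<longleftrightarrow> (\<exists>ps' cur us vs. store_ok n k d nx cm nc R s \<and> nmem s 8 3 = r \<and>
     output_paths s (ps' @ [cur]) \<and> cur \<noteq> [] \<and> ps' @ cut d B cur vs = goal \<and>
     rmem s n 1 = path_length d cur \<and> nmem s 8 8 = last cur \<and>
     nmem s 8 9 = (if vs = [] then r else hd vs) \<and>
     cy r = us @ vs \<and> us \<noteq> [] \<and> last us = last cur \<and> m = length vs)"

lemma runs_advance:
  assumes r: "r \<in> reps n cm" and I: "cutting k nc r goal m s" and b: "bval (neq (cell 9) (cell 3)) s"
  shows "runs advance_prog s 11 (\<lambda>s'. \<exists>m'<m. cutting k nc r goal m' s')"
proof -
  obtain ps' cur us vs where s: "store_ok n k d nx cm nc R s" "nmem s 8 3 = r"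
    "output_paths s (ps' @ [cur])" "cur \<noteq> []" "ps' @ cut d B cur vs = goal"
    "rmem s n 1 = path_length d cur" "nmem s 8 8 = last cur"
    "nmem s 8 9 = (if vs = [] then r else hd vs)"
    "cy r = us @ vs" "us \<noteq> []" "last us = last cur" "m = length vs"
    using I unfolding cutting_def by blast
  have "vs \<noteq> []" using b s by auto
  then obtain v vs' where vs: "vs = v # vs'" by (cases vs) auto
  have tr: "tour nx (us @ v # vs')" "hd (us @ v # vs') = r" "set (us @ v # vs') = cluster n cm r"
    using tours r unfolding s(9)[unfolded vs, symmetric] by (simp_all add: tours_def)
  have nxt: "nx v = (if vs' = [] then r else hd vs')" by (rule tour_next[OF tr(1,2)])
  have "last cur \<in> set us" using s(10,11) by (metis last_in_set)
  then have "last cur < n" "v < n" using tr(3) by (auto simp: cluster_def)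
  then have dist: "rmem s (last cur) v = d (last cur) v" using s(1) by (simp add: store_ok_def)
  have cells: "nmem s 8 9 = v" "nmem s 8 0 = n" "rmem s n 0 = R" "nmem s 6 = nx"
    using s(1,8) vs by (auto simp: store_ok_def)
  define c where "c = (if B < path_length d cur + d (last cur) v then new_piece_prog (cell 9) else extend_prog)"
  define s1 where "s1 = final c s"
  have fin: "final advance_prog s = nupdate 8 9 (nx v) (nupdate 8 8 v s1)" if "nmem s1 8 = nmem s 8" "nmem s1 6 = nx"
  proof -
    have "bval (RLess (RAdd (twice (twice (twice radius))) (twice (twice radius)))
        (RAdd so_far (RLoad (cell 8) (cell 9)))) s \<longleftrightarrow> B < path_length d cur + d (last cur) v"
      using s(6,7) cells dist by simp
    then have "final (If (RLess (RAdd (twice (twice (twice radius))) (twice (twice radius)))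
        (RAdd so_far (RLoad (cell 8) (cell 9)))) (new_piece_prog (cell 9)) extend_prog) s = s1"
      by (simp only: final.simps s1_def c_def) (rule if_distrib[of "\<lambda>c. final c s", symmetric])
    then have "final advance_prog s = final (Seq (assign 8 (cell 9)) (assign 9 (NLoad (NConst 6) (cell 9)))) s1"
      by (simp only: advance_prog_def final.simps(4))
    then show ?thesis using that cells by simp
  qed
  have "cutting k nc r goal (length vs') (nupdate 8 9 (nx v) (nupdate 8 8 v s1)) \<and> nmem s1 8 = nmem s 8 \<and> nmem s1 6 = nx"
  proof (cases "B < path_length d cur + d (last cur) v")
    case True
    then have c: "s1 = final (new_piece_prog (cell 9)) s" by (simp add: s1_def c_def)
    note np = final_new_piece[OF s(1,3) cells(1), folded c]
    have "cutting k nc r goal (length vs') (nupdate 8 9 (nx v) (nupdate 8 8 v s1))"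
      unfolding cutting_def
      by (rule exI[of _ "ps' @ [cur]"], rule exI[of _ "[v]"], rule exI[of _ "us @ [v]"], rule exI[of _ vs'])
        (use np s(2,5,9) True nxt in \<open>auto simp: vs\<close>)
    then show ?thesis using np(1,4) by (simp add: store_ok_def)
  next
    case False
    then have c: "s1 = final extend_prog s" by (simp add: s1_def c_def)
    note ex = final_extend[OF s(1,3,4,7) cells(1), folded c]
    have "cutting k nc r goal (length vs') (nupdate 8 9 (nx v) (nupdate 8 8 v s1))"
      unfolding cutting_def
      by (rule exI[of _ ps'], rule exI[of _ "cur @ [v]"], rule exI[of _ "us @ [v]"], rule exI[of _ vs'])
        (use ex s(2,4,5,6,9) False nxt dist in \<open>auto simp: vs path_length_append\<close>)
    then show ?thesis using ex(1,4) by (simp add: store_ok_def)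
  qed
  then have "cutting k nc r goal (length vs') (final advance_prog s)" using fin by simp
  moreover have "length vs' < m" using vs s(12) by simp
  ultimately have "\<exists>m'<m. cutting k nc r goal m' (final advance_prog s)" by blast
  moreover have "loop_free advance_prog" "steps advance_prog \<le> 11"
    by (simp_all add: advance_prog_def new_piece_prog_def extend_prog_def)
  ultimately show ?thesis by (intro runs_loop_free)
qed

lemma runs_cut_tour:
  assumes s: "store_ok n k d nx cm nc R s" "nmem s 8 3 = r" "output_paths s (pieces n d cm cy B r)" and r: "r < n"
  shows "runs cut_tour_prog s (12 * n + 9) (\<lambda>s'. store_ok n k d nx cm nc R s' \<and> nmem s' 8 3 = r \<and>
    output_paths s' (pieces n d cm cy B (Suc r)))"
  (is "runs _ _ _ ?Q")
proof -
  have cells: "nmem s 7 r = cm r" "nmem s 6 = nx" using s(1) by (auto simp: store_ok_def)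
  have "runs cut_tour_prog s (Suc (7 + (n * (11 + 1) + 1))) ?Q"
    unfolding cut_tour_prog_def
  proof (rule runs_If)
    assume "bval (neq (NLoad (NConst 7) (cell 3)) (cell 3)) s"
    then have "cm r \<noteq> r" using cells s(2) by auto
    then show "runs Skip s (7 + (n * (11 + 1) + 1)) ?Q"
      using s by (intro runs_loop_free) (auto simp: pieces_def)
  next
    assume "\<not> bval (neq (NLoad (NConst 7) (cell 3)) (cell 3)) s"
    then have cmr: "cm r = r" using cells s(2) by auto
    then have rep: "r \<in> reps n cm" using r by (simp add: reps_def)
    define goal where "goal = pieces n d cm cy B (Suc r)"
    have goal: "goal = pieces n d cm cy B r @ cuts r" using cmr by (simp add: goal_def pieces_def)
    have cy: "cy r = [r] @ tl (cy r)" using tours_Cons[OF tours rep] by simp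
    have tr: "tour nx ([] @ r # tl (cy r))" "set (cy r) = cluster n cm r"
      using tours rep cy by (auto simp: tours_def)
    have nxr: "nx r = (if tl (cy r) = [] then r else hd (tl (cy r)))"
      by (rule tour_next[OF tr(1)]) simp
    have len: "length (tl (cy r)) \<le> n"
    proof -
      have "distinct (cy r)" using tours rep by (auto simp: tours_def tour_def)
      then have "length (cy r) = card (cluster n cm r)" using tr(2) by (metis distinct_card)
      also have "\<dots> \<le> card {..<n}" by (rule card_mono) (auto simp: cluster_def)
      finally show ?thesis by simp
    qed
    note np = final_new_piece[OF s(1,3,2)]
    show "runs (Seq (Seq (new_piece_prog (cell 3)) (Seq (assign 8 (cell 3)) (assign 9 (NLoad (NConst 6) (cell 3)))))
       (While (neq (cell 9) (cell 3)) advance_prog)) s (7 + (n * (11 + 1) + 1)) ?Q"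
    proof (rule runs_Seq[where P = "cutting k nc r goal (length (tl (cy r)))"])
      define s1 where "s1 = final (new_piece_prog (cell 3)) s"
      have "nmem s1 6 = nx" using np(1) by (simp add: s1_def store_ok_def)
      then have fin: "final (Seq (new_piece_prog (cell 3)) (Seq (assign 8 (cell 3)) (assign 9 (NLoad (NConst 6) (cell 3))))) s
          = nupdate 8 9 (nx r) (nupdate 8 8 r s1)"
        using np(4) s(2) by (simp add: s1_def)
      have "cutting k nc r goal (length (tl (cy r))) (nupdate 8 9 (nx r) (nupdate 8 8 r s1))"
        unfolding cutting_def
        by (rule exI[of _ "pieces n d cm cy B r"], rule exI[of _ "[r]"], rule exI[of _ "[r]"], rule exI[of _ "tl (cy r)"])
          (use np[folded s1_def] s(2) goal nxr cy in auto)
      then show "runs (Seq (new_piece_prog (cell 3)) (Seq (assign 8 (cell 3)) (assign 9 (NLoad (NConst 6) (cell 3))))) s 7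
          (cutting k nc r goal (length (tl (cy r))))"
        by (intro runs_loop_free) (simp_all add: fin del: final.simps, simp_all add: new_piece_prog_def)
    next
      fix s' assume s': "cutting k nc r goal (length (tl (cy r))) s'"
      have "runs (While (neq (cell 9) (cell 3)) advance_prog) s' (length (tl (cy r)) * (11 + 1) + 1)
        (\<lambda>s'. (\<exists>m'. cutting k nc r goal m' s') \<and> \<not> bval (neq (cell 9) (cell 3)) s')"
        by (rule runs_While[where I = "cutting k nc r goal"]) (use runs_advance[OF rep] s' in auto)
      then show "runs (While (neq (cell 9) (cell 3)) advance_prog) s' (n * (11 + 1) + 1) ?Q"
      proof (rule runs_mono)
        show "length (tl (cy r)) * (11 + 1) + 1 \<le> n * (11 + 1) + 1" using len by simp
        fix s' assume "(\<exists>m'. cutting k nc r goal m' s') \<and> \<not> bval (neq (cell 9) (cell 3)) s'"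
        then obtain ps' cur us vs where f: "store_ok n k d nx cm nc R s'" "nmem s' 8 3 = r"
            "output_paths s' (ps' @ [cur])" "ps' @ cut d B cur vs = goal"
            "nmem s' 8 9 = (if vs = [] then r else hd vs)" "cy r = us @ vs" "us \<noteq> []"
          and b: "\<not> bval (neq (cell 9) (cell 3)) s'"
          unfolding cutting_def by blast
        \<comment> \<open>The loop stops when cell 9 holds \<open>r\<close>. A point still ahead
          cannot be \<open>r\<close>, which already occurs in \<open>us\<close>.\<close>
        have "vs = []"
        proof (rule ccontr)
          assume ne: "vs \<noteq> []"
          then have "hd vs = r" using b f(2,5) by auto
          then have "r \<in> set vs" using ne hd_in_set by metis
          moreover have "r \<in> set us" using cy f(6,7) by (cases us) auto
          moreover have "distinct (us @ vs)"
            using tours rep unfolding f(6)[symmetric] by (simp add: tours_def tour_def)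
          ultimately show False by auto
        qed
        then show "?Q s'" using f by (simp add: goal_def)
      qed
    qed
  qed
  then show ?thesis by (rule runs_mono) auto
qed

lemma runs_cut_prog:
  assumes "store_ok n k d nx cm nc R s"
  shows "runs cut_prog s (n * (12 * n + 11) + 5) (\<lambda>s'. store_ok n k d nx cm nc R s' \<and> output_paths s' ps)"
proof -
  let ?I = "\<lambda>i s. store_ok n k d nx cm nc R s \<and> output_paths s (pieces n d cm cy B i)"
  have loop: "runs (for_upto 3 cut_tour_prog) s (n * (12 * n + 9 + 2) + 2) (?I n)" if s: "?I 0 s" for s
  proof (rule runs_for_upto[where I = ?I])
    show "nmem s 8 0 = n" using s by (simp add: store_ok_def)
    show "?I 0 (nupdate 8 3 0 s)" using s by simp
    fix i s assume i: "i < n" "nmem s 8 3 = i" "nmem s 8 0 = n" "?I i s"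
    show "runs cut_tour_prog s (12 * n + 9) (\<lambda>s'. nmem s' 8 3 = i \<and> nmem s' 8 0 = n \<and> ?I (Suc i) (nupdate 8 3 (Suc i) s'))"
      by (rule runs_mono[OF runs_cut_tour[OF _ i(2) _ i(1)]]) (use i(4) in \<open>auto simp: store_ok_def\<close>)
  qed simp
  have "runs cut_prog s (3 + (n * (12 * n + 9 + 2) + 2)) (?I n)"
    unfolding cut_prog_def
    by (rule runs_Seq[OF runs_loop_free loop])
      (use assms in \<open>auto simp: output_paths_def output_tree_def path_graph_Nil pieces_def\<close>)
  then show ?thesis by (rule runs_mono) (auto simp: algebra_simps)
qed

end


section \<open>The algorithm\<close>

definition step_prog :: com where
  "step_prog = Seq find_prog (Seq
     (If (BNot (BAnd (BNot (NLess (cell 1) (cell 2)))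
            (BNot (BAnd (NLess (NConst 0) (cell 7)) (BNot (RLess (twice radius) (RLoad (cell 5) (cell 6))))))))
        merge_prog double_prog)
     cut_prog)"

definition tree_cover_prog :: com where
  "tree_cover_prog = Seq init_prog (Seq cut_prog (While (NLess (cell 1) (count 0)) step_prog))"

text \<open>A doubling keeps the first summand of the measure \<open>m\<close>; a merge decreases the number of clusters
  and may reset the number \<open>j\<close> of doublings since the last merge to 0.\<close>

definition clustered :: "nat \<Rightarrow> nat \<Rightarrow> (nat \<Rightarrow> nat \<Rightarrow> real) \<Rightarrow> nat \<Rightarrow> state \<Rightarrow> bool" where
  "clustered n k d m s \<longleftrightarrow> (\<exists>nx cm R e w j. clustering n d nx cm R e w \<and> certificate k n cm R w \<and>
     store_ok n k d nx cm (card (reps n cm)) R s \<and>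
     R = 2 ^ j * e \<and> j \<le> n \<and> m = card (reps n cm) * (n + 1) + (n - j))"

definition covered :: "nat \<Rightarrow> nat \<Rightarrow> (nat \<Rightarrow> nat \<Rightarrow> real) \<Rightarrow> nat \<Rightarrow> state \<Rightarrow> bool" where
  "covered n k d m s \<longleftrightarrow> (\<exists>nx cm R e w cy j. cut_clustering n d nx cm R e w cy \<and> certificate k n cm R w \<and>
     store_ok n k d nx cm (card (reps n cm)) R s \<and> output_paths s (pieces n d cm cy (12 * R) n) \<and>
     R = 2 ^ j * e \<and> j \<le> n \<and> m = card (reps n cm) * (n + 1) + (n - j))"

lemma runs_cut_clustered:
  assumes metric: "Metric_space {..<n} d" and "clustered n k d m s"
  shows "runs cut_prog s (n * (12 * n + 11) + 5) (covered n k d m)"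
proof -
  obtain nx cm R e w j where s: "clustering n d nx cm R e w" "certificate k n cm R w"
      "store_ok n k d nx cm (card (reps n cm)) R s"
    and j: "R = 2 ^ j * e" "j \<le> n" "m = card (reps n cm) * (n + 1) + (n - j)"
    using assms(2) unfolding clustered_def by blast
  obtain cy where "tours n nx cm cy" using clustering_tours[OF s(1)] .
  then interpret cut_clustering n d nx cm R e w cy
    using metric s(1) by (simp add: cut_clustering_def)
  show ?thesis
  proof (rule runs_mono[OF runs_cut_prog[OF s(3)]])
    fix s' assume "store_ok n k d nx cm (card (reps n cm)) R s' \<and> output_paths s' ps"
    then show "covered n k d m s'"
      unfolding covered_def using cut_clustering_axioms s(2) j by blast
  qed simp
qed

text \<open>The reason for the chosen branch yields the new certificate: a doubling and a merge
  within \<open>2 * R\<close> inherit it from the cut that gave too many pieces, a merge with more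
  than \<open>k\<close> clusters gets the trivial one.\<close>

lemma runs_step:
  assumes metric: "Metric_space {..<n} d" and k: "0 < k"
    and s: "covered n k d m s" and b: "bval (NLess (cell 1) (count 0)) s"
  shows "runs step_prog s (18 * (n * n) + 19 * n + 18) (\<lambda>s'. \<exists>m'<m. covered n k d m' s')"
proof -
  obtain nx cm R e w cy j where "cut_clustering n d nx cm R e w cy"
      and cert: "certificate k n cm R w"
      and ok: "store_ok n k d nx cm (card (reps n cm)) R s"
      and out: "output_paths s (pieces n d cm cy (12 * R) n)"
      and j: "R = 2 ^ j * e" "j \<le> n" "m = card (reps n cm) * (n + 1) + (n - j)"
    using s unfolding covered_def by blast
  then interpret cut_clustering n d nx cm R e w cy by simp
  have long: "k < length ps" using b ok out by (simp add: store_ok_def output_paths_def)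
  have cmr: "\<forall>v<n. cm v \<in> reps n cm" and e: "0 \<le> e" using clustering by (simp_all add: clustering_def)
  define nc where "nc = card (reps n cm)"
  let ?all = "{..<n} \<times> {..<n}"
  let ?P = "\<lambda>s'. \<exists>m'<m. clustered n k d m' s'"
  let ?b = "BNot (BAnd (BNot (NLess (cell 1) (cell 2)))
            (BNot (BAnd (NLess (NConst 0) (cell 7)) (BNot (RLess (twice radius) (RLoad (cell 5) (cell 6)))))))"
  have branch: "runs (If ?b merge_prog double_prog) s (Suc (4 * n + 9)) ?P"
    if s: "store_ok n k d nx cm nc R s" "closest_pair n d cm ?all s" for s
  proof (rule runs_If)
    let ?u = "nmem s 8 5" and ?v = "nmem s 8 6"
    assume b: "bval ?b s"
    \<comment> \<open>A crossing pair exists in either case: the test saw one, or there are more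
      than \<open>k \<ge> 1\<close> clusters.\<close>
    have "nmem s 8 7 \<noteq> 0"
    proof
      assume z: "nmem s 8 7 = 0"
      then have "k < nc" using b s(1) by (auto simp: store_ok_def)
      then have "1 < card (reps n cm)" using k by (simp add: nc_def)
      then obtain r t where rt: "r \<in> reps n cm" "t \<in> reps n cm" "r \<noteq> t"
        by (metis One_nat_def card_le_Suc0_iff_eq finite_reps not_less)
      then have "(r, t) \<in> ?all" by (simp add: reps_def)
      from bspec[OF s(2)[unfolded closest_pair_def if_P[OF z]] this] have "cm r = cm t" by simp
      then show False using rt by (simp add: reps_def)
    qed
    then have uv: "?u < n" "?v < n" "cm ?u \<noteq> cm ?v"
      and min: "\<And>x y. x < n \<Longrightarrow> y < n \<Longrightarrow> cm x \<noteq> cm y \<Longrightarrow> d ?u ?v \<le> d x y"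
      using s(2) by (auto simp: closest_pair_def)
    let ?cm = "merged n cm ?u ?v" and ?w = "w(cm ?u := w (cm ?u) + w (cm ?v) + d ?u ?v)"
    let ?nx = "nx(?u := nx ?v, ?v := nx ?u)"
    have cl: "clustering n d ?nx ?cm (d ?u ?v) (d ?u ?v) ?w"
      by (rule clustering_merge[OF metric clustering uv min])
    have nc1: "card (reps n ?cm) = nc - 1" "1 \<le> nc"
    proof -
      have "cm ?v \<in> reps n cm" using cmr uv by simp
      then show "card (reps n ?cm) = nc - 1" "1 \<le> nc"
        unfolding nc_def merged_reps(1)[OF cmr uv]
        by (auto simp: Suc_le_eq card_gt_0_iff)
    qed
    have cert': "certificate k n ?cm (d ?u ?v) ?w"
    proof (cases "k < nc")
      case True
      obtain cy' where "tours n ?nx ?cm cy'" using clustering_tours[OF cl] .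
      then have "cut_clustering n d ?nx ?cm (d ?u ?v) (d ?u ?v) ?w cy'"
        using metric cl by (simp add: cut_clustering_def)
      then show ?thesis
        by (rule cut_clustering.certificate_trivial) (use True nc1 in simp)
    next
      case False
      then have "d ?u ?v \<le> R + R" using b s(1) uv by (auto simp: store_ok_def)
      then show ?thesis by (rule certificate_merge[OF long uv])
    qed
    \<comment> \<open>Losing a cluster lowers the measure by \<open>n + 1\<close>, more than
      resetting \<open>j \<le> n\<close> to 0 can add.\<close>
    have less: "(nc - 1) * (n + 1) + (n - 0) < m"
    proof -
      obtain nc' where "nc = Suc nc'" using nc1(2) by (cases nc) auto
      then show ?thesis using j(3) by (simp add: nc_def[symmetric])
    qed
    show "runs merge_prog s (4 * n + 9) ?P"
    proof (rule runs_mono[OF runs_merge_prog[OF s(1) refl refl uv(1,2)]])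
      fix s' assume "store_ok n k d ?nx ?cm (nc - 1) (d ?u ?v) s'"
      then have "clustered n k d ((nc - 1) * (n + 1) + (n - 0)) s'"
        unfolding clustered_def
        using cl cert' nc1
        by (intro exI[of _ ?nx] exI[of _ ?cm] exI[of _ "d ?u ?v"] exI[of _ ?w] exI[of _ 0]) simp
      then show "?P s'" using less by blast
    qed simp
  next
    assume b: "\<not> bval ?b s"
    then have few: "nc \<le> k" using s(1) by (auto simp: store_ok_def)
    have far: "R + R \<le> d u v" if "u < n" "v < n" "cm u \<noteq> cm v" for u v
    proof (cases "nmem s 8 7 = 0")
      case True
      have "(u, v) \<in> ?all" using that by simp
      from bspec[OF s(2)[unfolded closest_pair_def if_P[OF True]] this] have "cm u = cm v" by simp
      then show ?thesis using that by simp
    next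
      case False
      then have "nmem s 8 5 < n" "nmem s 8 6 < n" "d (nmem s 8 5) (nmem s 8 6) \<le> d u v"
        using s(2) that by (auto simp: closest_pair_def)
      then show ?thesis using b False s(1) by (auto simp: store_ok_def)
    qed
    have cl: "clustering n d nx cm (R + R) e w"
      by (rule clustering_raise[OF clustering _ far]) (use R_nonneg in auto)
    \<comment> \<open>A doubling is reached only if \<open>6 * 2 ^ j < n\<close>; the strict
      inequality between the multiples of \<open>e\<close> permits its cancellation.\<close>
    have "Suc j \<le> n"
    proof -
      have "6 * (2 ^ j * e) < real n * e" using long_tour[of k] few long j(1) by (simp add: nc_def)
      then have "(6 * 2 ^ j) * e < real n * e" by simp
      then have "6 * 2 ^ j < real n" using e by (rule mult_right_less_imp_less)
      moreover have "real j < 2 ^ j" by (rule of_nat_less_two_power)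
      ultimately have "real j < real n" by linarith
      then show ?thesis by simp
    qed
    then have less: "nc * (n + 1) + (n - Suc j) < m" using j(3) by (simp add: nc_def)
    show "runs double_prog s (4 * n + 9) ?P"
    proof (rule runs_mono[OF runs_double_prog[OF s(1)]])
      fix s' assume "store_ok n k d nx cm nc (R + R) s'"
      then have "clustered n k d (nc * (n + 1) + (n - Suc j)) s'"
        unfolding clustered_def nc_def
        using cl certificate_double[OF long] \<open>Suc j \<le> n\<close> j(1)
        by (intro exI[of _ nx] exI[of _ cm] exI[of _ "R + R"] exI[of _ e] exI[of _ w] exI[of _ "Suc j"]) simp
      then show "?P s'" using less by blast
    qed simp
  qed
  have "runs step_prog s ((n * (n * 6 + 4) + 3) + (Suc (4 * n + 9) + (n * (12 * n + 11) + 5)))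
      (\<lambda>s'. \<exists>m'<m. covered n k d m' s')"
    unfolding step_prog_def
  proof (rule runs_Seq[OF runs_find_prog[OF ok]], rule runs_Seq[OF branch])
    fix s' assume "?P s'"
    then obtain m' where "m' < m" "clustered n k d m' s'" by blast
    then show "runs cut_prog s' (n * (12 * n + 11) + 5) (\<lambda>s'. \<exists>m'<m. covered n k d m' s')"
      by (intro runs_mono[OF runs_cut_clustered[OF metric]]) auto
  qed (auto simp: nc_def)
  then show ?thesis by (rule runs_mono) (auto simp: algebra_simps)
qed

text \<open>Initially there are \<open>n\<close> clusters and no doublings, so the measure is
  quadratic in \<open>n\<close>; a step costs quadratic time as well, which gives the fourth
  power.\<close>

lemma runs_tree_cover_prog:
  assumes metric: "Metric_space {..<n} d" and k: "0 < k"
  shows "runs tree_cover_prog (input_state n d k) (100 * (n + 1) ^ 4)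
    (\<lambda>s. \<exists>nx cm R e w cy. cut_clustering n d nx cm R e w cy \<and> certificate k n cm R w \<and>
       output_paths s (pieces n d cm cy (12 * R) n) \<and> length (pieces n d cm cy (12 * R) n) \<le> k)"
  (is "runs _ _ _ ?Q")
proof -
  let ?id = "\<lambda>i. if i < n then i else 0"
  let ?m = "n * (n + 1) + n" and ?K = "18 * (n * n) + 19 * n + 18"
  have init: "clustered n k d ?m s" if "store_ok n k d ?id ?id n 0 s" for s
  proof -
    have "clustering n d ?id ?id 0 0 (\<lambda>_. 0)" "reps n ?id = {..<n}"
      by (rule clustering_init[OF metric]; simp)+
    then show ?thesis unfolding clustered_def using that
      by (intro exI[of _ ?id] exI[of _ 0] exI[of _ "\<lambda>_. 0"]) (simp add: certificate_def)
  qed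
  have "runs tree_cover_prog (input_state n d k)
      ((4 * n + 5) + ((n * (12 * n + 11) + 5) + (?m * (?K + 1) + 1)))
      (\<lambda>s. (\<exists>m. covered n k d m s) \<and> \<not> bval (NLess (cell 1) (count 0)) s)"
    unfolding tree_cover_prog_def
    by (rule runs_Seq[OF runs_init_prog], rule runs_Seq[OF runs_cut_clustered[OF metric init]], assumption,
        rule runs_While[where I = "covered n k d"], rule runs_step[OF metric k], assumption+)
  then show ?thesis
  proof (rule runs_mono)
    show "(4 * n + 5) + ((n * (12 * n + 11) + 5) + (?m * (?K + 1) + 1)) \<le> 100 * (n + 1) ^ 4"
      by (simp add: power4_eq_xxxx algebra_simps)
    fix s assume "(\<exists>m. covered n k d m s) \<and> \<not> bval (NLess (cell 1) (count 0)) s"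
    then obtain nx cm R e w cy where *: "cut_clustering n d nx cm R e w cy" "certificate k n cm R w"
        "store_ok n k d nx cm (card (reps n cm)) R s" "output_paths s (pieces n d cm cy (12 * R) n)"
        "\<not> bval (NLess (cell 1) (count 0)) s"
      unfolding covered_def by blast
    then have "length (pieces n d cm cy (12 * R) n) \<le> k" by (simp add: store_ok_def output_paths_def)
    then show "?Q s" using * by blast
  qed
qed

theorem theorem5:
  shows "\<exists>(c :: com) (q :: nat poly).
    \<forall>(n :: nat) (d :: nat \<Rightarrow> nat \<Rightarrow> real) (k :: nat).
      Metric_space {..<n} d \<and> k > 0 \<longrightarrow>
      (\<exists>t s. exec c (input_state n d k) t s \<and> t \<le> poly q n \<and>
         finite (output_trees s) \<and> card (output_trees s) \<le> k \<and>
         (\<forall>T\<in>output_trees s. tree_in {..<n} T) \<and>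
         (\<Union>T\<in>output_trees s. verts T) = {..<n} \<and>
         (\<forall>(p :: real) (T' :: nat \<Rightarrow> nat ugraph). p \<ge> 1 \<and> tree_cover {..<n} k T' \<longrightarrow>
            (\<Sum>T\<in>output_trees s. weight d T powr p) powr (1 / p)
              \<le> 14 * (\<Sum>i<k. weight d (T' i) powr p) powr (1 / p)))"
proof (rule exI[of _ tree_cover_prog], rule exI[of _ "[:100:] * [:1, 1:] ^ 4 :: nat poly"],
    intro allI impI, elim conjE)
  fix n k :: nat and d :: "nat \<Rightarrow> nat \<Rightarrow> real"
  assume metric: "Metric_space {..<n} d" and k: "k > 0"
  have poly: "poly ([:100:] * [:1, 1:] ^ 4) n = 100 * (n + 1) ^ 4" by (simp add: poly_power)
  obtain t s nx cm R e w cy where ex: "exec tree_cover_prog (input_state n d k) t s" "t \<le> 100 * (n + 1) ^ 4"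
    and "cut_clustering n d nx cm R e w cy" and cert: "certificate k n cm R w"
    and out: "output_paths s (pieces n d cm cy (12 * R) n)" and len: "length (pieces n d cm cy (12 * R) n) \<le> k"
    using runs_tree_cover_prog[OF metric k] unfolding runs_def by blast
  then interpret cut_clustering n d nx cm R e w cy by simp
  let ?T = "\<lambda>i. path_graph (ps ! i)"
  have trees: "output_trees s = ?T ` {..<length ps}"
    using out by (auto simp: output_trees_def output_paths_def)
  have cover: "(\<Union>p\<in>set ps. set p) = {..<n}"
    by (rule pieces_cover[OF tours]) (use clustering in \<open>simp add: clustering_def\<close>)
  have tree: "tree_in {..<n} (?T i)" if "i < length ps" for i
  proof (rule path_graph_tree)
    have "ps ! i \<in> set ps" using that by simp
    then show "ps ! i \<noteq> []" "distinct (ps ! i)" "set (ps ! i) \<subseteq> {..<n}"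
      using pieces_path[OF tours] cover by blast+
  qed
  have verts: "(\<Union>T\<in>output_trees s. verts T) = {..<n}"
  proof -
    have "set ps = (!) ps ` {..<length ps}" by (auto simp: set_conv_nth)
    then show ?thesis unfolding cover[symmetric] by (simp add: trees path_graph_def)
  qed
  have approx: "(\<Sum>T\<in>output_trees s. weight d T powr p) powr (1 / p)
      \<le> 14 * (\<Sum>i<k. weight d (T' i) powr p) powr (1 / p)"
    if p: "1 \<le> p" and T': "tree_cover {..<n} k T'" for p T'
  proof -
    \<comment> \<open>\<open>output_trees s\<close> is a set: equal trees coincide in it, which can
      only lower the sum over the pieces.\<close>
    have "(\<Sum>T\<in>output_trees s. weight d T powr p) \<le> (\<Sum>i<length ps. weight d (?T i) powr p)"
      using sum_image_le[of "{..<length ps}" "\<lambda>T. weight d T powr p" ?T] by (simp add: trees)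
    also have "\<dots> \<le> (\<Sum>i<length ps. path_length d (ps ! i) powr p)"
      by (intro sum_mono powr_mono2 weight_path_graph_le[OF metric] weight_path_graph_nonneg[OF metric])
        (use p in simp)
    finally have "(\<Sum>T\<in>output_trees s. weight d T powr p) powr (1 / p)
        \<le> (\<Sum>i<length ps. path_length d (ps ! i) powr p) powr (1 / p)"
      using p by (intro powr_mono2) (auto intro: sum_nonneg)
    also have "\<dots> \<le> 14 * (\<Sum>i<k. weight d (T' i) powr p) powr (1 / p)"
      by (rule pieces_approximate[OF cert T' p])
    finally show ?thesis .
  qed
  have "card (output_trees s) \<le> k"
    unfolding trees using card_image_le[of "{..<length ps}" ?T] len by simp
  then show "\<exists>t s. exec tree_cover_prog (input_state n d k) t s \<and> t \<le> poly ([:100:] * [:1, 1:] ^ 4) n \<and>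
         finite (output_trees s) \<and> card (output_trees s) \<le> k \<and>
         (\<forall>T\<in>output_trees s. tree_in {..<n} T) \<and>
         (\<Union>T\<in>output_trees s. verts T) = {..<n} \<and>
         (\<forall>(p :: real) (T' :: nat \<Rightarrow> nat ugraph). p \<ge> 1 \<and> tree_cover {..<n} k T' \<longrightarrow>
            (\<Sum>T\<in>output_trees s. weight d T powr p) powr (1 / p)
              \<le> 14 * (\<Sum>i<k. weight d (T' i) powr p) powr (1 / p))"
    using ex tree verts approx unfolding poly
    by (intro exI[of _ t] exI[of _ s] conjI) (auto simp: trees)
qed

end
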